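(* For all integers $n\ge 0$ and $k\ge 1$, the function $\Phi$ of Ossona de Mendez and Rosenstiehl, from rooted maps to matchings (described in the context), is a weight-preserving bijection from rooted maps in orientable surfaces with $k$ vertices and $n$ edges to connected matchings on $2n+2$ vertices of weight $c^{k-1}$.
   Context: Matchings. A complete matching on $2m$ vertices is a partition of $\{1,\dots,2m\}$ into edges $(a,b)$, $a<b$. The edge $(a,b)$ nests a vertex $v$ if $a<v<b$ and nests an edge $(a',b')$ if $a<a'<b'<b$. A matching on $2m$ vertices is connected if every vertex except $1$ and $2m$ is nested by an edge; equivalently, writing the matching as a double occurrence word (a word of length $2m$ in $m$ letters, each appearing exactly twice, the two occurrences of a letter marking the endpoints of an edge), the word is not a concatenation of two nonempty double occurrence words. The weight of a connected matching is the product of its edge weights, where each edge not nested by another edge has weight $c$, except that the edge containing vertex $1$ has weight $1$, and every nested edge has weight $1$. Maps. A map in an orientable surface is a connected graph (loops and multiple edges allowed) embedded in an oriented closed surface, with faces homeomorphic to discs; it is encoded by the counterclockwise cyclic order of the edge ends (half-edges) around each vertex. A rooted map is a map with one edge oriented, equivalently with one distinguished edge end, the root, incident with the vertex at the head of the root edge (the root vertex); rooted maps are taken up to root-preserving isomorphism, and there is one rooted map with $0$ edges (a single vertex). Each vertex has weight $c$ except the root vertex, which has weight $1$; the weight of a map is the product of its vertex weights, so a map with $k$ vertices has weight $c^{k-1}$. The function $\Phi$. Given a rooted map with $n$ edges, label its edges, and add a new loop labeled $\alpha$ at the root vertex so that, reading counterclockwise around the root vertex, one meets first one end of $\alpha$,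 then the root, then the other original edge ends at that vertex in counterclockwise order, and last the other end of $\alpha$. Build a word as follows. First write the labels of the edge ends around the root vertex in this order, beginning with one $\alpha$ and ending with the other $\alpha$. Then repeat: find the leftmost letter in the current word that has occurred only once; go to the other (unvisited) end of that edge; this end is at a vertex not visited before; read the edge ends around that vertex counterclockwise, starting just after this end and finishing with it, and append the labels to the word. Stop when all vertices have been visited. The result is a double occurrence word in $n+1$ letters, and $\Phi$ of the rooted map is the corresponding matching on $2n+2$ vertices. *)

theory Defs
  imports
    "HOL-Combinatorics.Orbits"
    "HOL-Computational_Algebra.Polynomial"
    "HOL-Library.Disjoint_Sets"
    "HOL-Library.Infinite_Typeclass"
    "HOL-Library.While_Combinator"
begin

text \<open>The weight \<open>c\<close> is an indeterminate, so that the exponent of \<open>c\<close> can be read off from a weight.\<close>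

definition weight_c :: "int poly" where
  "weight_c = [:0, 1:]"


section \<open>Matchings\<close>

definition complete_matching :: "nat \<Rightarrow> (nat \<times> nat) set \<Rightarrow> bool" where
  "complete_matching m E \<longleftrightarrow>
     (\<forall>(a, b) \<in> E. a < b) \<and> partition_on {1..2 * m} ((\<lambda>(a, b). {a, b}) ` E)"

definition nests_vertex :: "nat \<times> nat \<Rightarrow> nat \<Rightarrow> bool" where
  "nests_vertex e v \<longleftrightarrow> fst e < v \<and> v < snd e"

definition nests_edge :: "nat \<times> nat \<Rightarrow> nat \<times> nat \<Rightarrow> bool" where
  "nests_edge e e' \<longleftrightarrow> fst e < fst e' \<and> fst e' < snd e' \<and> snd e' < snd e"

definition connected_matching :: "nat \<Rightarrow> (nat \<times> nat) set \<Rightarrow> bool" where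
  "connected_matching m E \<longleftrightarrow>
     complete_matching m E \<and> (\<forall>v \<in> {1..2 * m} - {1, 2 * m}. \<exists>e \<in> E. nests_vertex e v)"

definition edge_weight :: "(nat \<times> nat) set \<Rightarrow> nat \<times> nat \<Rightarrow> int poly" where
  "edge_weight E e =
     (if (\<exists>e' \<in> E. nests_edge e' e) then 1
      else if 1 \<in> {fst e, snd e} then 1
      else weight_c)"

definition matching_weight :: "(nat \<times> nat) set \<Rightarrow> int poly" where
  "matching_weight E = (\<Prod>e\<in>E. edge_weight E e)"


section \<open>Rooted maps\<close>

text \<open>
  A map in an oriented closed surface is given by a finite connected graph whose edges are split
  into edge ends: \<open>vert d\<close> is the vertex of the end \<open>d\<close>, \<open>opp d\<close> is the other end of its edge, and
  \<open>ccw d\<close> is the end following \<open>d\<close> counterclockwise around \<open>vert d\<close>. The values of these functions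
  outside \<open>ends\<close> are irrelevant. The root is \<open>None\<close> only for the map without edges.
\<close>

record ('v, 'd) rmap =
  verts :: "'v set"
  ends :: "'d set"
  vert :: "'d \<Rightarrow> 'v"
  opp :: "'d \<Rightarrow> 'd"
  ccw :: "'d \<Rightarrow> 'd"
  root_end :: "'d option"

definition ends_at :: "('v, 'd) rmap \<Rightarrow> 'v \<Rightarrow> 'd set" where
  "ends_at M v = {d \<in> ends M. vert M d = v}"

definition edge_of :: "('v, 'd) rmap \<Rightarrow> 'd \<Rightarrow> 'd set" where
  "edge_of M d = {d, opp M d}"

definition edges :: "('v, 'd) rmap \<Rightarrow> 'd set set" where
  "edges M = edge_of M ` ends M"

definition connected_graph :: "('v, 'd) rmap \<Rightarrow> bool" where
  "connected_graph M \<longleftrightarrow>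
     verts M \<noteq> {} \<and>
     (\<forall>v \<in> verts M. \<forall>w \<in> verts M. (v, w) \<in> {(vert M d, vert M (opp M d)) | d. d \<in> ends M}\<^sup>*)"

definition rooted_map :: "('v, 'd) rmap \<Rightarrow> bool" where
  "rooted_map M \<longleftrightarrow>
     finite (verts M) \<and> finite (ends M) \<and>
     (\<forall>d \<in> ends M. vert M d \<in> verts M) \<and>
     (\<forall>d \<in> ends M. opp M d \<in> ends M \<and> opp M d \<noteq> d \<and> opp M (opp M d) = d) \<and>
     (\<forall>v \<in> verts M. ends_at M v \<noteq> {} \<longrightarrow> cyclic_on (ccw M) (ends_at M v)) \<and>
     connected_graph M \<and>
     (case root_end M of None \<Rightarrow> ends M = {} | Some r \<Rightarrow> r \<in> ends M)"

definition root_vertex :: "('v, 'd) rmap \<Rightarrow> 'v" where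
  "root_vertex M = (case root_end M of None \<Rightarrow> the_elem (verts M) | Some r \<Rightarrow> vert M r)"

definition map_weight :: "('v, 'd) rmap \<Rightarrow> int poly" where
  "map_weight M = (\<Prod>v \<in> verts M. if v = root_vertex M then 1 else weight_c)"

definition isomorphic :: "('v, 'd) rmap \<Rightarrow> ('w, 'e) rmap \<Rightarrow> bool" where
  "isomorphic M N \<longleftrightarrow>
     (\<exists>f g. bij_betw f (verts M) (verts N) \<and> bij_betw g (ends M) (ends N) \<and>
        (\<forall>d \<in> ends M. vert N (g d) = f (vert M d) \<and>
                       opp N (g d) = g (opp M d) \<and>
                       ccw N (g d) = g (ccw M d)) \<and>
        root_end N = map_option g (root_end M))"

definition map_iso :: "(('v, 'd) rmap \<times> ('v, 'd) rmap) set" where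
  "map_iso = {(M, N). rooted_map M \<and> rooted_map N \<and> isomorphic M N}"

lemma equiv_map_iso: "equiv {M :: ('v, 'd) rmap. rooted_map M} map_iso"
proof (rule equivI)
  show "map_iso \<subseteq> {M :: ('v, 'd) rmap. rooted_map M} \<times> {M. rooted_map M}"
    by (auto simp: map_iso_def)
  show "refl_on {M :: ('v, 'd) rmap. rooted_map M} map_iso"
  proof (rule refl_onI)
    fix M :: "('v, 'd) rmap"
    assume "M \<in> {M. rooted_map M}"
    then show "(M, M) \<in> map_iso"
      unfolding map_iso_def isomorphic_def
      by (auto simp: option.map_ident intro!: exI[of _ "\<lambda>x::'v. x"] exI[of _ "\<lambda>x::'d. x"]
            bij_betw_id[unfolded id_def])
  qed
  show "sym (map_iso :: (('v, 'd) rmap \<times> ('v, 'd) rmap) set)"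
  proof (rule symI)
    fix M N :: "('v, 'd) rmap"
    assume "(M, N) \<in> map_iso"
    then obtain f g where M: "rooted_map M" and N: "rooted_map N"
      and f: "bij_betw f (verts M) (verts N)" and g: "bij_betw g (ends M) (ends N)"
      and *: "\<forall>d \<in> ends M. vert N (g d) = f (vert M d) \<and>
                 opp N (g d) = g (opp M d) \<and> ccw N (g d) = g (ccw M d)"
      and r: "root_end N = map_option g (root_end M)"
      unfolding map_iso_def isomorphic_def by blast
    let ?f = "inv_into (verts M) f" and ?g = "inv_into (ends M) g"
    have ccw: "ccw M d \<in> ends M" if "d \<in> ends M" for d
    proof -
      have "vert M d \<in> verts M" "d \<in> ends_at M (vert M d)"
        using M that by (auto simp: rooted_map_def ends_at_def)
      then have "cyclic_on (ccw M) (ends_at M (vert M d))"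
        using M unfolding rooted_map_def by blast
      then have "ccw M d \<in> ends_at M (vert M d)"
        using \<open>d \<in> ends_at M (vert M d)\<close> by (rule cyclic_on_inI)
      then show ?thesis by (simp add: ends_at_def)
    qed
    have inv: "?g (g d) = d" if "d \<in> ends M" for d
      using g that by (simp add: bij_betw_inv_into_left)
    have "vert M (?g e) = ?f (vert N e) \<and> opp M (?g e) = ?g (opp N e) \<and>
          ccw M (?g e) = ?g (ccw N e)" if "e \<in> ends N" for e
    proof -
      obtain d where d: "d \<in> ends M" "e = g d"
        using g \<open>e \<in> ends N\<close> by (auto simp: bij_betw_def)
      have "vert M d \<in> verts M" "opp M d \<in> ends M"
        using M d by (auto simp: rooted_map_def)
      then show ?thesis
        using d * f ccw by (simp add: inv bij_betw_inv_into_left)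
    qed
    moreover have "root_end M = map_option ?g (root_end N)"
      using M r inv by (auto simp: rooted_map_def split: option.splits)
    ultimately show "(N, M) \<in> map_iso"
      using M N bij_betw_inv_into[OF f] bij_betw_inv_into[OF g]
      unfolding map_iso_def isomorphic_def
      by (intro CollectI case_prodI conjI exI[of _ ?f] exI[of _ ?g]) auto
  qed
  show "trans (map_iso :: (('v, 'd) rmap \<times> ('v, 'd) rmap) set)"
  proof (rule transI)
    fix M N P :: "('v, 'd) rmap"
    assume "(M, N) \<in> map_iso" "(N, P) \<in> map_iso"
    then obtain f g f' g' where MP: "rooted_map M" "rooted_map P"
      and f: "bij_betw f (verts M) (verts N)" and g: "bij_betw g (ends M) (ends N)"
      and f': "bij_betw f' (verts N) (verts P)" and g': "bij_betw g' (ends N) (ends P)"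
      and 1: "\<forall>d \<in> ends M. vert N (g d) = f (vert M d) \<and>
                 opp N (g d) = g (opp M d) \<and> ccw N (g d) = g (ccw M d)"
      and 2: "\<forall>d \<in> ends N. vert P (g' d) = f' (vert N d) \<and>
                 opp P (g' d) = g' (opp N d) \<and> ccw P (g' d) = g' (ccw N d)"
      and r: "root_end N = map_option g (root_end M)" "root_end P = map_option g' (root_end N)"
      unfolding map_iso_def isomorphic_def by blast
    have "g d \<in> ends N" if "d \<in> ends M" for d
      using g that by (auto simp: bij_betw_def)
    then have "isomorphic M P"
      unfolding isomorphic_def
      using bij_betw_trans[OF f f'] bij_betw_trans[OF g g'] 1 2 r
      by (intro exI[of _ "f' \<circ> f"] exI[of _ "g' \<circ> g"]) (simp add: option.map_comp)
    then show "(M, P) \<in> map_iso"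
      using MP by (simp add: map_iso_def)
  qed
qed

definition rooted_maps :: "nat \<Rightarrow> nat \<Rightarrow> ('v, 'd) rmap set" where
  "rooted_maps n k = {M. rooted_map M \<and> card (edges M) = n \<and> card (verts M) = k}"


section \<open>The function of Ossona de Mendez and Rosenstiehl\<close>

datatype 'd with_loop = LoopFirst | LoopLast | Old 'd

text \<open>
  Adding the loop \<open>\<alpha>\<close> with ends \<open>LoopFirst\<close> and \<open>LoopLast\<close>: they are inserted, in the order
  \<open>LoopLast\<close>, \<open>LoopFirst\<close>, immediately before the root in the counterclockwise order. The
  resulting map is rooted at \<open>LoopFirst\<close>.
\<close>

definition add_loop :: "('v, 'd) rmap \<Rightarrow> ('v, 'd with_loop) rmap" where
  "add_loop M =
     \<lparr>verts = verts M,
      ends = {LoopFirst, LoopLast} \<union> Old ` ends M,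
      vert = case_with_loop (root_vertex M) (root_vertex M) (vert M),
      opp = case_with_loop LoopLast LoopFirst (\<lambda>d. Old (opp M d)),
      ccw = case_with_loop
              (case root_end M of None \<Rightarrow> LoopLast | Some r \<Rightarrow> Old r)
              LoopFirst
              (\<lambda>d. if root_end M = Some (ccw M d) then LoopLast else Old (ccw M d)),
      root_end = Some LoopFirst\<rparr>"

definition degree_at :: "('v, 'd) rmap \<Rightarrow> 'd \<Rightarrow> nat" where
  "degree_at M d = card (ends_at M (vert M d))"

definition read_from :: "('v, 'd) rmap \<Rightarrow> 'd \<Rightarrow> 'd list" where
  "read_from M d = map (\<lambda>i. (ccw M ^^ i) d) [0..<degree_at M d]"

definition read_after :: "('v, 'd) rmap \<Rightarrow> 'd \<Rightarrow> 'd list" where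
  "read_after M d = map (\<lambda>i. (ccw M ^^ i) d) [1..<degree_at M d + 1]"

text \<open>
  The word is kept as the list of the ends read so far; its letters are the edges containing these
  ends, i.e. every edge is its own label.
\<close>

definition word_of_ends :: "('v, 'd) rmap \<Rightarrow> 'd list \<Rightarrow> 'd set list" where
  "word_of_ends M ds = map (edge_of M) ds"

definition leftmost_single :: "('v, 'd) rmap \<Rightarrow> 'd list \<Rightarrow> 'd" where
  "leftmost_single M ds =
     the (find (\<lambda>d. count_list (word_of_ends M ds) (edge_of M d) = 1) ds)"

definition visit_next :: "('v, 'd) rmap \<Rightarrow> 'd list \<Rightarrow> 'd list" where
  "visit_next M ds = ds @ read_after M (opp M (leftmost_single M ds))"

definition traversal :: "('v, 'd) rmap \<Rightarrow> 'd list" where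
  "traversal M =
     while (\<lambda>ds. vert M ` set ds \<noteq> verts M) (visit_next M) (read_from M (the (root_end M)))"

definition matching_of_word :: "'a list \<Rightarrow> (nat \<times> nat) set" where
  "matching_of_word w = {(i + 1, j + 1) | i j. i < j \<and> j < length w \<and> w ! i = w ! j}"

definition Phi :: "('v, 'd) rmap \<Rightarrow> (nat \<times> nat) set" where
  "Phi M = matching_of_word (word_of_ends (add_loop M) (traversal (add_loop M)))"

definition Phi_class :: "('v, 'd) rmap set \<Rightarrow> (nat \<times> nat) set" where
  "Phi_class C = the_elem (Phi ` C)"

end

theory Submission
  imports Defs
begin

text \<open>
  In the word of a map with the loop \<open>\<alpha>\<close>, each vertex contributes a block of consecutive letters. A
  block ends with the second occurrence of the leftmost letter that was unmatched before it, and
  these are exactly the second occurrences of the letters of unnested edges. Hence the blocks, and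
  with them the vertices and the cyclic orders around them, can be read off from the matching; in
  particular unnested edges correspond to vertices, which explains the weights. A list of all ends
  that is compatible with these blocks (a reading) is unique, so that the traversal is the only
  reading. An isomorphism maps readings to readings, two maps with the same matching are isomorphic
  along their readings, and a connected matching is cut into blocks to obtain a map for which its
  positions form a reading.
\<close>


section \<open>Cyclic orders and rooted maps\<close>

text \<open>The obstacle is that \<open>traversal\<close> is a loop whose next step depends on
  counting letters, so two traversals are awkward to compare. A reading replaces the loop by
  conditions on positions that mention only \<open>root_end\<close>, \<open>opp\<close> and
  \<open>ccw\<close>; that the loop meets them is proved once, and afterwards a traversal is
  computed by exhibiting a reading. A block closes an unnested edge for this reason: when it is
  appended, all letters left of the chosen one have occurred twice, so no edge opened earlier can
  close later, and the chosen edge closes at the very end of the block. The loop \<alpha> makes the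
  first block obey the same rule: it opens with one end of \<alpha>, its leftmost letter, and closes
  with the other. Connectedness corresponds on both sides: as long as a vertex is missing, some
  letter is unmatched; conversely, the edge closing a block of a connected matching, other than the
  first block, starts in an earlier block.\<close>

lemma cyclic_on_funpow_list:
  assumes "cyclic_on f S" "x \<in> S"
  shows "distinct (map (\<lambda>i. (f ^^ i) x) [0..<card S])"
    and "set (map (\<lambda>i. (f ^^ i) x) [0..<card S]) = S"
    and "(f ^^ card S) x = x"
proof -
  have S: "S = orbit f x" using assms by (simp add: cyclic_on_alldef)
  then have x: "x \<in> orbit f x" using assms by simp
  define n where "n = funpow_dist1 f x x"
  have orb: "S = (\<lambda>n. (f ^^ n) x) ` {0..<n}"
    using orbit_conv_funpow_dist1[OF x] S unfolding n_def by simp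
  have inj: "inj_on (\<lambda>n. (f ^^ n) x) {0..<n}"
    using inj_on_funpow_dist1[OF x] unfolding n_def .
  have card: "card S = n"
    unfolding orb by (simp add: card_image[OF inj])
  show "(f ^^ card S) x = x"
    unfolding card n_def by (rule funpow_dist1_prop[OF x])
  show "distinct (map (\<lambda>i. (f ^^ i) x) [0..<card S])"
    unfolding card using inj by (simp add: distinct_map)
  show "set (map (\<lambda>i. (f ^^ i) x) [0..<card S]) = S"
    unfolding card using orb by simp
qed

text \<open>Recognises rotations that are given explicitly: those around the root vertex after the
  loop is added, and the intervals of positions in the map of a matching.\<close>

lemma cyclic_on_listI:
  assumes "xs \<noteq> []"
    and step: "\<And>i. Suc i < length xs \<Longrightarrow> f (xs ! i) = xs ! Suc i"
    and close: "f (last xs) = hd xs"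
  shows "cyclic_on f (set xs)"
proof -
  have pow: "(f ^^ i) (hd xs) = xs ! i" if "i < length xs" for i
    using that by (induction i) (auto simp: hd_conv_nth assms(1) step)
  have full: "(f ^^ length xs) (hd xs) = hd xs"
  proof -
    obtain m where m: "length xs = Suc m"
      using assms(1) by (cases "length xs") auto
    then have "(f ^^ length xs) (hd xs) = f (xs ! m)"
      using pow[of m] by simp
    also have "\<dots> = hd xs" using close m by (simp add: last_conv_nth[OF assms(1)])
    finally show ?thesis .
  qed
  have "orbit f (hd xs) = set xs"
  proof (rule set_eqI, rule iffI)
    fix y assume "y \<in> orbit f (hd xs)"
    then show "y \<in> set xs"
    proof induction
      case base
      then show ?case
      proof (cases "length xs = 1")
        case True
        then have "f (hd xs) = hd xs" using full by simp
        then show ?thesis using assms(1) by simp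
      next
        case False
        then have "1 < length xs" using assms(1) by (simp add: nat_neq_iff)
        then show ?thesis using pow[of 1] by simp
      qed
    next
      case (step y)
      then obtain i where i: "i < length xs" "y = xs ! i" by (auto simp: in_set_conv_nth)
      show ?case
      proof (cases "Suc i < length xs")
        case True then show ?thesis using assms(2) i by auto
      next
        case False
        then have "i = length xs - 1" using i by linarith
        then have "y = last xs" using i by (simp add: last_conv_nth[OF assms(1)])
        then show ?thesis using close assms(1) by simp
      qed
    qed
  next
    fix y assume "y \<in> set xs"
    then obtain i where i: "i < length xs" "y = xs ! i" by (auto simp: in_set_conv_nth)
    \<comment> \<open>\<open>orbit\<close> contains only iterates with positive exponent; an extra
      full turn covers \<open>i = 0\<close>.\<close>
    have "y = (f ^^ (i + length xs)) (hd xs)"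
      using i pow[of i] full by (simp add: funpow_add)
    moreover have "i + length xs > 0" using assms(1) by simp
    ultimately show "y \<in> orbit f (hd xs)" unfolding orbit_altdef by blast
  qed
  then show ?thesis unfolding cyclic_on_def using assms(1) by (metis hd_in_set)
qed

section \<open>Rotations, edges and connectedness of a fixed rooted map\<close>

context
  fixes M :: "('v, 'd) rmap"
  assumes M: "rooted_map M"
begin

lemma finite_ends: "finite (ends M)"
  and finite_verts: "finite (verts M)"
  and vert_in: "d \<in> ends M \<Longrightarrow> vert M d \<in> verts M"
  and opp_in: "d \<in> ends M \<Longrightarrow> opp M d \<in> ends M"
  and opp_neq: "d \<in> ends M \<Longrightarrow> opp M d \<noteq> d"
  and opp_opp: "d \<in> ends M \<Longrightarrow> opp M (opp M d) = d"
  and verts_nonempty: "verts M \<noteq> {}"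
  using M by (auto simp: rooted_map_def connected_graph_def)

lemma cyclic_ends_at: "d \<in> ends M \<Longrightarrow> cyclic_on (ccw M) (ends_at M (vert M d))"
  using M vert_in[of d] by (auto simp: rooted_map_def ends_at_def)

lemma ccw_in: "d \<in> ends M \<Longrightarrow> ccw M d \<in> ends M"
  and vert_ccw: "d \<in> ends M \<Longrightarrow> vert M (ccw M d) = vert M d"
  using cyclic_on_inI[OF cyclic_ends_at[of d], of d] by (auto simp: ends_at_def)

lemma finite_ends_at: "finite (ends_at M v)"
  using finite_ends by (simp add: ends_at_def)

lemma ends_at_eq_orbit: "d \<in> ends M \<Longrightarrow> ends_at M (vert M d) = orbit (ccw M) d"
  using cyclic_ends_at[of d] by (simp add: cyclic_on_alldef ends_at_def)

lemma opp_eq_iff: "d \<in> ends M \<Longrightarrow> e \<in> ends M \<Longrightarrow> opp M d = opp M e \<longleftrightarrow> d = e"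
  using opp_opp by metis

lemma edge_of_eq_iff:
  "d \<in> ends M \<Longrightarrow> e \<in> ends M \<Longrightarrow> edge_of M d = edge_of M e \<longleftrightarrow> e = d \<or> e = opp M d"
  unfolding edge_of_def doubleton_eq_iff using opp_opp by metis

lemma card_ends: "card (ends M) = 2 * card (edges M)"
proof -
  have U: "\<Union>(edges M) = ends M"
    using opp_in by (auto simp: edges_def edge_of_def)
  have "2 * card (edges M) = card (\<Union>(edges M))"
  proof (rule card_partition)
    show "finite (edges M)" "finite (\<Union>(edges M))"
      using finite_ends by (simp_all add: edges_def edge_of_def)
    show "card c = 2" if c: "c \<in> edges M" for c
    proof -
      obtain d where d: "d \<in> ends M" "c = {d, opp M d}"
        using c by (auto simp: edges_def edge_of_def)
      then show ?thesis using opp_neq[of d] by auto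
    qed
    show "c1 \<inter> c2 = {}" if c: "c1 \<in> edges M" "c2 \<in> edges M" "c1 \<noteq> c2" for c1 c2
    proof -
      obtain d e where d: "d \<in> ends M" "c1 = edge_of M d" and e: "e \<in> ends M" "c2 = edge_of M e"
        using c(1,2) unfolding edges_def by blast
      then have "e \<noteq> d" "e \<noteq> opp M d" "opp M e \<noteq> d" "opp M e \<noteq> opp M d"
        using c(3) edge_of_eq_iff[of d e] opp_opp opp_eq_iff by auto
      then show ?thesis using d e by (auto simp: edge_of_def)
    qed
  qed
  then show ?thesis using U by simp
qed

text \<open>A path from \<open>v\<close> to a vertex outside \<open>V\<close> has a step leaving
  \<open>V\<close>. Applied to the visited vertices, this keeps the traversal going.\<close>

lemma exists_leaving_end:
  assumes "v \<in> V" "V \<subseteq> verts M" "V \<noteq> verts M"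
  obtains d where "d \<in> ends M" "vert M d \<in> V" "vert M (opp M d) \<notin> V"
proof -
  obtain w where w: "w \<in> verts M" "w \<notin> V" using assms by blast
  have "(v, w) \<in> {(vert M d, vert M (opp M d)) | d. d \<in> ends M}\<^sup>*"
    using M assms w unfolding rooted_map_def connected_graph_def by blast
  then have "w \<in> V \<or> (\<exists>d \<in> ends M. vert M d \<in> V \<and> vert M (opp M d) \<notin> V)"
    using assms(1) by (induction rule: rtrancl_induct) auto
  then show thesis using w that by blast
qed

lemma verts_eq_vert_ends:
  assumes "ends M \<noteq> {}"
  shows "verts M = vert M ` ends M"
proof (rule ccontr)
  assume "verts M \<noteq> vert M ` ends M"
  moreover obtain d where "d \<in> ends M" using assms by blast
  ultimately show False
    using exists_leaving_end[of "vert M d" "vert M ` ends M"] vert_in opp_in by blast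
qed

lemma verts_eq_singleton:
  assumes "ends M = {}"
  shows "verts M = {the_elem (verts M)}"
proof -
  obtain v where v: "v \<in> verts M" using verts_nonempty by blast
  have "verts M = {v}"
  proof (rule ccontr)
    assume "verts M \<noteq> {v}"
    then show False using exists_leaving_end[of v "{v}"] v assms by blast
  qed
  then show ?thesis by (metis the_elem_eq)
qed

lemma ends_empty_iff: "root_end M = None \<longleftrightarrow> ends M = {}"
  and root_in: "root_end M = Some r \<Longrightarrow> r \<in> ends M"
  using M by (auto simp: rooted_map_def split: option.splits)

lemma root_vertex_in: "root_vertex M \<in> verts M"
proof (cases "root_end M")
  case None
  then have "verts M = {the_elem (verts M)}" using ends_empty_iff verts_eq_singleton by blast
  then show ?thesis unfolding root_vertex_def None by auto
next
  case (Some r)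
  then show ?thesis using root_in[of r] vert_in by (simp add: root_vertex_def)
qed

lemma map_weight_eq: "map_weight M = weight_c ^ (card (verts M) - 1)"
proof -
  have "map_weight M = (\<Prod>v \<in> verts M - {root_vertex M}. if v = root_vertex M then 1 else weight_c)"
    unfolding map_weight_def
    by (subst prod.remove[OF finite_verts root_vertex_in]) simp
  also have "\<dots> = (\<Prod>v \<in> verts M - {root_vertex M}. weight_c)"
    by (rule prod.cong) auto
  finally show ?thesis using finite_verts root_vertex_in by simp
qed

lemma ends_at_list:
  assumes "d \<in> ends M"
  defines "xs \<equiv> map (\<lambda>i. (ccw M ^^ i) d) [0..<degree_at M d]"
  shows "distinct xs" "set xs = ends_at M (vert M d)" "(ccw M ^^ degree_at M d) d = d"
  using cyclic_on_funpow_list[OF cyclic_ends_at[OF assms(1)], of d] assms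
  unfolding xs_def degree_at_def ends_at_def by auto

lemma degree_at_pos: "d \<in> ends M \<Longrightarrow> degree_at M d > 0"
  using finite_ends_at by (auto simp: degree_at_def card_gt_0_iff ends_at_def)

text \<open>Brings the first block into the form of the later ones: in the map with the loop, the
  root is the counterclockwise successor of the other end of \<alpha>.\<close>

lemma read_from_ccw:
  assumes "d \<in> ends M"
  shows "read_from M (ccw M d) = read_after M d"
proof -
  have "degree_at M (ccw M d) = degree_at M d"
    using vert_ccw[OF assms] by (simp add: degree_at_def)
  then show ?thesis
    unfolding read_from_def read_after_def
    by (simp add: map_Suc_upt[symmetric] funpow_swap1 comp_def del: upt_Suc)
qed

lemma read_after:
  assumes "d \<in> ends M"
  shows "distinct (read_after M d)" "set (read_after M d) = ends_at M (vert M d)"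
    "read_after M d \<noteq> []" "last (read_after M d) = d" "read_after M d ! 0 = ccw M d"
    "\<And>i. Suc i < length (read_after M d) \<Longrightarrow> ccw M (read_after M d ! i) = read_after M d ! Suc i"
proof -
  note c = ccw_in[OF assms] vert_ccw[OF assms] read_from_ccw[OF assms]
  show "distinct (read_after M d)" "set (read_after M d) = ends_at M (vert M d)"
    using ends_at_list(1,2)[OF c(1)] c(2) unfolding c(3)[symmetric] read_from_def by simp_all
  show ne: "read_after M d \<noteq> []" "read_after M d ! 0 = ccw M d"
    using degree_at_pos[OF assms] by (simp_all add: read_after_def del: upt_Suc)
  show "last (read_after M d) = d"
    using ends_at_list(3)[OF assms] degree_at_pos[OF assms] ne
    by (simp add: read_after_def last_conv_nth del: upt_Suc)
  show "ccw M (read_after M d ! i) = read_after M d ! Suc i" if "Suc i < length (read_after M d)" for i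
    using that by (simp add: read_after_def del: upt_Suc)
qed

end


section \<open>Readings of a rooted map\<close>

text \<open>
  The ends of the vertex blocks in a word are the second occurrences of the letters of unnested
  edges. This is phrased so that it only depends on the prefix of the word up to the position.
\<close>

definition block_end :: "('v, 'd) rmap \<Rightarrow> 'd list \<Rightarrow> nat \<Rightarrow> bool" where
  "block_end A L b \<longleftrightarrow> b < length L \<and>
     (\<exists>a<b. L ! b = opp A (L ! a) \<and> (\<forall>a'<a. opp A (L ! a') \<in> set (take b L)))"

definition is_block :: "('v, 'd) rmap \<Rightarrow> 'd list \<Rightarrow> nat \<Rightarrow> nat \<Rightarrow> bool" where
  "is_block A L s b \<longleftrightarrow> s \<le> b \<and> (s = 0 \<or> block_end A L (s - 1)) \<and> block_end A L b \<and>
     (\<forall>t. s \<le> t \<longrightarrow> t < b \<longrightarrow> \<not> block_end A L t)"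

text \<open>Vertices are deliberately absent, so that the conditions can be transported along
  bijections of ends. The existence of an unmatched end in every proper prefix both determines the
  next block and later yields connectedness of the matching; the last condition closes the rotation
  of each block.\<close>

definition partial_reading :: "('v, 'd) rmap \<Rightarrow> 'd list \<Rightarrow> bool" where
  "partial_reading A L \<longleftrightarrow>
     distinct L \<and> set L \<subseteq> ends A \<and> (L \<noteq> [] \<longrightarrow> root_end A = Some (L ! 0)) \<and>
     (\<forall>i. Suc i < length L \<longrightarrow> (\<exists>a\<le>i. opp A (L ! a) \<notin> set (take (Suc i) L))) \<and>
     (\<forall>i. Suc i < length L \<longrightarrow> \<not> block_end A L i \<longrightarrow> ccw A (L ! i) = L ! Suc i) \<and>
     (\<forall>s b. is_block A L s b \<longrightarrow> ccw A (L ! b) = L ! s)"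

definition reading :: "('v, 'd) rmap \<Rightarrow> 'd list \<Rightarrow> bool" where
  "reading A L \<longleftrightarrow> partial_reading A L \<and> set L = ends A"

lemma readingD:
  assumes "reading A L"
  shows "distinct L" "set L = ends A" "L \<noteq> [] \<Longrightarrow> root_end A = Some (L ! 0)"
    "\<And>i. Suc i < length L \<Longrightarrow> \<exists>a\<le>i. opp A (L ! a) \<notin> set (take (Suc i) L)"
    "\<And>i. Suc i < length L \<Longrightarrow> \<not> block_end A L i \<Longrightarrow> ccw A (L ! i) = L ! Suc i"
    "\<And>s b. is_block A L s b \<Longrightarrow> ccw A (L ! b) = L ! s"
  using assms unfolding reading_def partial_reading_def by blast+

text \<open>Partners are only searched to the left of \<open>b\<close>, so nothing behind
  \<open>b\<close> matters.\<close>

lemma block_end_append: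
  assumes "b < length xs"
  shows "block_end A (xs @ ys) b \<longleftrightarrow> block_end A xs b"
proof -
  have "(xs @ ys) ! a = xs ! a" if "a \<le> b" for a
    using assms that by (simp add: nth_append)
  then show ?thesis
    using assms unfolding block_end_def by (intro conj_cong ex_cong) (auto simp: less_imp_le)
qed

lemma block_end_take:
  assumes "b < length L"
  shows "block_end A (take (Suc b) L) b \<longleftrightarrow> block_end A L b"
  using block_end_append[of b "take (Suc b) L" A "drop (Suc b) L"] assms by simp

lemma is_block_ex:
  assumes "block_end A L b"
  obtains s where "is_block A L s b"
proof -
  have "\<exists>s\<le>i. (s = 0 \<or> block_end A L (s - 1)) \<and> (\<forall>t. s \<le> t \<longrightarrow> t < i \<longrightarrow> \<not> block_end A L t)" for i
  proof (induction i)
    case (Suc i)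
    show ?case
    proof (cases "block_end A L i")
      case True then show ?thesis by (intro exI[of _ "Suc i"]) auto
    next
      case False
      from Suc obtain s where "s \<le> i" "s = 0 \<or> block_end A L (s - 1)"
        "\<forall>t. s \<le> t \<longrightarrow> t < i \<longrightarrow> \<not> block_end A L t" by blast
      then show ?thesis using False by (intro exI[of _ s]) (auto simp: less_Suc_eq)
    qed
  qed simp
  then show thesis using assms that unfolding is_block_def by blast
qed

text \<open>
  After a block the reading continues behind the partner of the leftmost end that is still
  unmatched, because that partner closes the next block.
\<close>

lemma reading_next_block:
  assumes L: "reading A L" and opp: "\<And>d. d \<in> ends A \<Longrightarrow> opp A d \<in> ends A"
    and i: "block_end A L i" "Suc i < length L"
    and a: "a \<le> i" "opp A (L ! a) \<notin> set (take (Suc i) L)"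
      "\<And>a'. a' < a \<Longrightarrow> opp A (L ! a') \<in> set (take (Suc i) L)"
  shows "L ! Suc i = ccw A (opp A (L ! a))"
proof -
  note dist = readingD(1)[OF L] and set = readingD(2)[OF L]
  have "L ! a \<in> ends A" using a i set[symmetric] by simp
  then obtain b where b: "b < length L" "L ! b = opp A (L ! a)"
    using opp set by (metis in_set_conv_nth)
  have mem: "L ! j \<in> set (take k L) \<longleftrightarrow> j < k" if "j < length L" for j k
    using that dist by (auto simp: in_set_conv_nth nth_eq_iff_index_eq)
  have ib: "i < b" using a(2) b mem[of b "Suc i"] by auto
  have "block_end A L b"
    unfolding block_end_def
    using b ib a set_take_subset_set_take[of "Suc i" b L] by (auto intro!: exI[of _ a])
  \<comment> \<open>Compare the opener \<open>a0\<close> of \<open>t\<close> with \<open>a\<close>: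
    if it is earlier, its partner was read by position \<open>i\<close>; if equal, then
    \<open>t = b\<close>; if later, the partner of \<open>a\<close> would have to stand before
    \<open>t\<close>.\<close>
  moreover have "\<not> block_end A L t" if t: "Suc i \<le> t" "t < b" for t
  proof
    assume "block_end A L t"
    then obtain a0 where a0: "a0 < t" "L ! t = opp A (L ! a0)"
      "\<forall>a'<a0. opp A (L ! a') \<in> set (take t L)" "t < length L"
      by (auto simp: block_end_def)
    consider "a0 < a" | "a0 = a" | "a < a0" by linarith
    then show False
    proof cases
      case 1
      then have "L ! t \<in> set (take (Suc i) L)" using a(3) a0 by simp
      then show ?thesis using mem[of t "Suc i"] a0 t by simp
    next
      case 2
      then have "L ! t = L ! b" using a0 b by simp
      then show ?thesis using nth_eq_iff_index_eq[OF dist a0(4) b(1)] t by simp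
    next
      case 3
      then have "L ! b \<in> set (take t L)" using a0 b by simp
      then show ?thesis using mem[of b t] b t by simp
    qed
  qed
  ultimately have "is_block A L (Suc i) b"
    unfolding is_block_def using i ib by auto
  then show ?thesis using readingD(6)[OF L] b by metis
qed

text \<open>Induction on prefixes. The next end is the \<open>ccw\<close> successor of the last one
  inside a block, and of the partner of the leftmost unmatched end after a block; which case applies
  is decided by the prefix.\<close>

lemma reading_unique:
  assumes A: "rooted_map A" and L: "reading A L" and L': "reading A L'"
  shows "L = L'"
proof -
  have len: "length L = length L'"
    using readingD(1,2)[OF L] readingD(1,2)[OF L'] by (metis distinct_card)
  have "take i L = take i L'" if "i \<le> length L" for i
    using that
  proof (induction i)
    case (Suc i)
    then have IH: "take i L = take i L'" and i: "i < length L" by simp_all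
    have "L ! i = L' ! i"
    proof (cases i)
      case 0
      then have "Some (L ! 0) = Some (L' ! 0)"
        using readingD(3)[OF L] readingD(3)[OF L'] i len by (metis length_0_conv not_less0)
      then show ?thesis using 0 by simp
    next
      case (Suc j)
      have eq: "L ! a = L' ! a" if "a \<le> j" for a
        using IH that Suc by (metis le_imp_less_Suc nth_take)
      have be: "block_end A L j \<longleftrightarrow> block_end A L' j"
        using block_end_take[of j L A] block_end_take[of j L' A] IH Suc i len by simp
      show ?thesis
      proof (cases "block_end A L j")
        case False
        then show ?thesis
          using readingD(5)[OF L, of j] readingD(5)[OF L', of j] be eq[of j] i Suc len by simp
      next
        case True
        let ?P = "\<lambda>a. opp A (L ! a) \<notin> set (take (Suc j) L)"
        define a where "a = (LEAST a. ?P a)"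
        obtain a0 where a0: "a0 \<le> j" "?P a0"
          using readingD(4)[OF L, of j] i Suc by blast
        have a: "?P a" "\<And>a'. a' < a \<Longrightarrow> \<not> ?P a'"
          unfolding a_def by (rule LeastI[of ?P, OF a0(2)], rule not_less_Least)
        have aj: "a \<le> j"
          using Least_le[of ?P, OF a0(2)] a0(1) unfolding a_def by (rule order_trans)
        have 1: "L ! Suc j = ccw A (opp A (L ! a))"
          by (rule reading_next_block[OF L opp_in[OF A]]) (use a aj True i Suc in auto)
        have 2: "L' ! Suc j = ccw A (opp A (L' ! a))"
          by (rule reading_next_block[OF L' opp_in[OF A]])
            (use a aj True be i Suc len IH eq in auto)
        show ?thesis using 1 2 eq aj Suc by simp
      qed
    qed
    then show ?case using IH i len by (simp add: take_Suc_conv_app_nth)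
  qed simp
  from this[of "length L"] show ?thesis using len by simp
qed

text \<open>The conditions relate ends only through \<open>opp\<close>, \<open>ccw\<close> and
  equality, all respected by \<open>g\<close>. In this way traversals are carried along
  isomorphisms.\<close>

lemma reading_map:
  assumes L: "reading A L" and A: "rooted_map A"
    and g: "bij_betw g (ends A) (ends B)"
    and opp: "\<And>d. d \<in> ends A \<Longrightarrow> opp B (g d) = g (opp A d)"
    and ccw: "\<And>d. d \<in> ends A \<Longrightarrow> ccw B (g d) = g (ccw A d)"
    and root: "root_end B = map_option g (root_end A)"
  shows "reading B (map g L)"
proof -
  have set: "set L = ends A" using L by (simp add: reading_def)
  have inj: "inj_on g (ends A)" using g by (simp add: bij_betw_def)
  have Ld: "L ! i \<in> ends A" if "i < length L" for i
    using that set[symmetric] by simp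
  have mem: "g d \<in> g ` set (take i L) \<longleftrightarrow> d \<in> set (take i L)" if "d \<in> ends A" for d i
    using inj that set set_take_subset[of i L] by (intro inj_on_image_mem_iff[of _ "ends A"]) auto
  have oppm: "opp B (map g L ! a) \<in> set (take i (map g L)) \<longleftrightarrow> opp A (L ! a) \<in> set (take i L)"
    if "a < length L" for a i
    using that opp Ld mem opp_in[OF A] by (simp add: take_map)
  have oppeq: "map g L ! b = opp B (map g L ! a) \<longleftrightarrow> L ! b = opp A (L ! a)"
    if "a < length L" "b < length L" for a b
    using that opp Ld opp_in[OF A] inj by (simp add: inj_on_eq_iff)
  have be: "block_end B (map g L) b \<longleftrightarrow> block_end A L b" for b
    unfolding block_end_def using oppm oppeq
    by (intro conj_cong ex_cong) auto
  have blk: "is_block B (map g L) s b \<longleftrightarrow> is_block A L s b" for s b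
    by (simp add: is_block_def be)
  have len: "is_block A L s b \<Longrightarrow> s < length L \<and> b < length L" for s b
    by (auto simp: is_block_def block_end_def)
  have pr: "partial_reading A L" using L by (simp add: reading_def)
  have "distinct (map g L)"
    using pr inj set by (simp add: partial_reading_def distinct_map)
  moreover have "set (map g L) = ends B" using set g by (simp add: bij_betw_def)
  moreover have "root_end B = Some (map g L ! 0)" if "L \<noteq> []"
    using pr that root by (simp add: partial_reading_def)
  moreover have "\<exists>a\<le>i. opp B (map g L ! a) \<notin> set (take (Suc i) (map g L))"
    if i: "Suc i < length L" for i
  proof -
    obtain a where "a \<le> i" "opp A (L ! a) \<notin> set (take (Suc i) L)"
      using pr i unfolding partial_reading_def by blast
    then show ?thesis using oppm[of a "Suc i"] i by (intro exI[of _ a]) auto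
  qed
  moreover have "ccw B (map g L ! i) = map g L ! Suc i"
    if "Suc i < length L" "\<not> block_end A L i" for i
    using pr that ccw Ld by (simp add: partial_reading_def)
  moreover have "ccw B (map g L ! b) = map g L ! s" if "is_block A L s b" for s b
    using pr that ccw Ld len by (simp add: partial_reading_def)
  ultimately show ?thesis
    unfolding reading_def partial_reading_def be blk by simp
qed

text \<open>The loop invariant of the traversal. It adds the facts on vertices that readings leave
  out: visited vertices are read completely, different blocks lie at different vertices, and the
  list stops at the end of a block. The empty list satisfies it, so the first block too can be
  appended.\<close>

definition block_reading :: "('v, 'd) rmap \<Rightarrow> 'd list \<Rightarrow> bool" where
  "block_reading A ds \<longleftrightarrow> partial_reading A ds \<and>
     (\<forall>d \<in> ends A. vert A d \<in> vert A ` set ds \<longrightarrow> d \<in> set ds) \<and>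
     (\<forall>b i j. block_end A ds b \<longrightarrow> i \<le> b \<longrightarrow> b < j \<longrightarrow> j < length ds \<longrightarrow>
        vert A (ds ! i) \<noteq> vert A (ds ! j)) \<and>
     (ds \<noteq> [] \<longrightarrow> block_end A ds (length ds - 1))"

lemma nth_mem_take_iff:
  "distinct xs \<Longrightarrow> j < length xs \<Longrightarrow> xs ! j \<in> set (take k xs) \<longleftrightarrow> j < k"
  by (auto simp: in_set_conv_nth nth_eq_iff_index_eq)

text \<open>Position \<open>a\<close> holds the partner of \<open>x\<close>, with everything before
  it already matched. For a later block it lies in \<open>ds\<close>; for the first block
  \<open>ds\<close> is empty and \<open>a = 0\<close> is the position of the root end inside the new
  block itself.\<close>

lemma block_reading_append:
  assumes A: "rooted_map A" and ds: "block_reading A ds"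
    and x: "x \<in> ends A" "x \<notin> set ds"
    and root: "ds = [] \<Longrightarrow> root_end A = Some (ccw A x)"
    and a: "Suc a < length (ds @ read_after A x)" "a = 0 \<or> a < length ds"
      "opp A ((ds @ read_after A x) ! a) = x"
      "\<And>a'. a' < a \<Longrightarrow> opp A (ds ! a') \<in> set ds"
  shows "block_reading A (ds @ read_after A x)"
proof -
  define es where "es = read_after A x"
  define L where "L = ds @ es"
  define n where "n = length ds"
  define N where "N = length L"
  note es = read_after[OF A x(1), folded es_def]
  note a = a[folded es_def, folded L_def, folded n_def, folded N_def]
  have N: "N = n + length es" by (simp add: N_def L_def n_def)
  have esne: "length es > 0" using es by simp
  have nN: "n < N" using N esne by simp
  have pr: "distinct ds" "set ds \<subseteq> ends A" "ds \<noteq> [] \<Longrightarrow> root_end A = Some (ds ! 0)"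
    "\<And>i. Suc i < n \<Longrightarrow> \<exists>a\<le>i. opp A (ds ! a) \<notin> set (take (Suc i) ds)"
    "\<And>i. Suc i < n \<Longrightarrow> \<not> block_end A ds i \<Longrightarrow> ccw A (ds ! i) = ds ! Suc i"
    "\<And>s b. is_block A ds s b \<Longrightarrow> ccw A (ds ! b) = ds ! s"
    using ds unfolding block_reading_def partial_reading_def n_def by blast+
  have closed: "d \<in> set ds" if "d \<in> ends A" "y \<in> set ds" "vert A d = vert A y" for d y
    using ds that unfolding block_reading_def by blast
  have sep: "vert A (ds ! i) \<noteq> vert A (ds ! j)" if "block_end A ds b" "i \<le> b" "b < j" "j < n" for b i j
    using ds that unfolding block_reading_def n_def by blast
  have lastds: "block_end A ds (n - 1)" if "n > 0"
    using ds that unfolding block_reading_def n_def by blast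
  have vx: "vert A y \<noteq> vert A x" if "y \<in> set ds" for y
    using closed[OF x(1) that] x(2) by auto
  have ves: "vert A y = vert A x" "y \<in> ends A" if "y \<in> set es" for y
    using that es by (auto simp: ends_at_def)
  have Lds: "L ! i = ds ! i" if "i < n" for i
    using that by (simp add: L_def n_def nth_append)
  have Les: "L ! i = es ! (i - n)" if "n \<le> i" for i
    using that by (simp add: L_def n_def nth_append)
  have Les_in: "L ! i \<in> set es" if "n \<le> i" "i < N" for i
    using that Les[OF that(1)] N by simp
  have dist: "distinct L"
    using pr(1) es(1) vx ves(1) unfolding L_def by auto
  have nN1: "n \<le> N - 1" using nN by simp
  have Lx: "L ! (N - 1) = x"
    using Les[OF nN1] N es(3,4) esne by (simp add: last_conv_nth)
  note mem = nth_mem_take_iff[OF dist, folded N_def]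
  have dsmem: "set ds = set (take n L)" by (simp add: L_def n_def)
  have be_old: "block_end A L b \<longleftrightarrow> block_end A ds b" if "b < n" for b
    using block_end_append that by (simp add: L_def n_def)
  have aN: "a < N - 1" using a(1) by simp
  have an: "a \<le> n" using a(2) by auto
  have oa: "opp A (L ! a') \<in> set ds" if "a' < a" for a'
    using a(4)[OF that] that an Lds by simp
  \<comment> \<open>\<open>x\<close> stands last and is the partner of position \<open>a\<close>;
    the partners of all ends before \<open>a\<close> are in \<open>ds\<close>.\<close>
  have be_last: "block_end A L (N - 1)"
    unfolding block_end_def
  proof (intro conjI exI[of _ a] allI impI)
    show "N - 1 < length L" using nN by (simp add: N_def)
    show "L ! (N - 1) = opp A (L ! a)" using Lx a(3) by simp
    show "opp A (L ! a') \<in> set (take (N - 1) L)" if "a' < a" for a'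
      using oa[OF that] set_take_subset_set_take[OF nN1, of L] dsmem by blast
  qed (use aN in auto)
  \<comment> \<open>If the opener \<open>a0\<close> of \<open>b\<close> precedes \<open>a\<close>,
    its partner lies in \<open>ds\<close>; if it follows \<open>a\<close>, then \<open>x\<close>
    would have to precede \<open>b\<close>, but \<open>x\<close> comes last.\<close>
  have be_new: "b = N - 1" if b: "n \<le> b" "block_end A L b" for b
  proof -
    obtain a0 where a0: "a0 < b" "L ! b = opp A (L ! a0)"
      "\<forall>a'<a0. opp A (L ! a') \<in> set (take b L)" "b < N"
      using b(2) by (auto simp: block_end_def N_def)
    consider "a0 < a" | "a0 = a" | "a < a0" by linarith
    then show ?thesis
    proof cases
      case 1
      then have "L ! b \<in> set (take n L)" using oa a0(2) dsmem by simp
      then show ?thesis using mem[of b n] a0 b by simp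
    next
      case 2
      then have "L ! b = L ! (N - 1)" using a0 a(3) Lx by simp
      then show ?thesis using nth_eq_iff_index_eq[OF dist, folded N_def, of b "N - 1"] a0(4) by simp
    next
      case 3
      then have "L ! (N - 1) \<in> set (take b L)" using a0 a(3) Lx by metis
      then have "N - 1 < b" using mem[of "N - 1" b] nN by simp
      then show ?thesis using a0(4) by simp
    qed
  qed
  have "set L \<subseteq> ends A" using pr(2) ves(2) by (auto simp: L_def)
  moreover have "root_end A = Some (L ! 0)"
  proof (cases "n = 0")
    case True
    then show ?thesis using root es(5) Les[of 0] by (simp add: n_def)
  next
    case False
    then show ?thesis using pr(3) Lds[of 0] by (simp add: n_def)
  qed
  moreover have "\<exists>a\<le>i. opp A (L ! a) \<notin> set (take (Suc i) L)" if i: "Suc i < N" for i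
  proof (cases "Suc i < n")
    case True
    then obtain a where "a \<le> i" "opp A (ds ! a) \<notin> set (take (Suc i) ds)"
      using pr(4) by blast
    then show ?thesis
      using True Lds[of a] by (intro exI[of _ a]) (auto simp: L_def n_def)
  next
    case False
    \<comment> \<open>From the end of \<open>ds\<close> on, the end at \<open>a\<close> stays
      unmatched until the last position, where \<open>x\<close> stands.\<close>
    then have "a \<le> i" using a(2) by auto
    moreover have "opp A (L ! a) \<notin> set (take (Suc i) L)"
      using a(3) Lx mem[of "N - 1" "Suc i"] i by simp
    ultimately show ?thesis by blast
  qed
  moreover have "ccw A (L ! i) = L ! Suc i" if i: "Suc i < N" "\<not> block_end A L i" for i
  proof -
    consider "Suc i < n" | "n = Suc i" | "n \<le> i" by linarith
    then show ?thesis
    proof cases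
      case 1
      then show ?thesis using pr(5)[of i] be_old[of i] Lds i by simp
    next
      case 2
      then show ?thesis using lastds be_old[of i] i by simp
    next
      case 3
      then show ?thesis using es(6)[of "i - n"] Les i N by (simp add: Suc_diff_le)
    qed
  qed
  moreover have "ccw A (L ! b) = L ! s" if blk: "is_block A L s b" for s b
  proof (cases "b < n")
    case True
    then have "is_block A ds s b"
      using blk be_old unfolding is_block_def by auto
    moreover have "s < n" using blk True by (simp add: is_block_def)
    ultimately show ?thesis using pr(6) Lds True by simp
  next
    case False
    then have b: "b = N - 1" using blk be_new by (simp add: is_block_def)
    \<comment> \<open>The new block starts exactly at \<open>n\<close>: if \<open>ds\<close> is
      nonempty, \<open>n - 1\<close> ends a block, and from \<open>n\<close> on only
      \<open>N - 1\<close> does.\<close>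
    have "\<not> s < n"
    proof
      assume "s < n"
      then have "\<not> block_end A L (n - 1)" using blk False unfolding is_block_def by auto
      then show False using \<open>s < n\<close> lastds be_old[of "n - 1"] by simp
    qed
    moreover have "\<not> n < s"
    proof
      assume "n < s"
      then have "s - 1 = N - 1" using blk be_new[of "s - 1"] by (auto simp: is_block_def)
      then show False using \<open>n < s\<close> blk b by (auto simp: is_block_def)
    qed
    ultimately have "s = n" by simp
    then show ?thesis using b Lx es(5) Les[of n] by simp
  qed
  moreover have "d \<in> set L" if "d \<in> ends A" "vert A d \<in> vert A ` set L" for d
  proof -
    obtain y where y: "y \<in> set L" "vert A d = vert A y" using \<open>vert A d \<in> vert A ` set L\<close> by auto
    show ?thesis
    proof (cases "y \<in> set ds")
      case True
      then show ?thesis using closed[OF that(1) True y(2)] by (simp add: L_def)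
    next
      case False
      then have "vert A d = vert A x" using y ves by (simp add: L_def)
      then show ?thesis using es(2) that(1) by (simp add: L_def ends_at_def)
    qed
  qed
  moreover have "vert A (L ! i) \<noteq> vert A (L ! j)"
    if be: "block_end A L b" and ij: "i \<le> b" "b < j" "j < N" for b i j
  proof -
    have bn: "b < n" using be be_new[of b] ij by (cases "n \<le> b") auto
    show ?thesis
    proof (cases "j < n")
      case True
      then show ?thesis using sep[of b i j] be be_old[OF bn] ij Lds by simp
    next
      case False
      then have "vert A (L ! j) = vert A x" using ves Les_in[of j] ij by simp
      moreover have "L ! i \<in> set ds" using Lds[of i] bn ij by (simp add: n_def)
      ultimately show ?thesis using vx by simp
    qed
  qed
  ultimately have "block_reading A L"
    unfolding block_reading_def partial_reading_def
    using dist be_last unfolding N_def by blast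
  then show ?thesis by (simp add: L_def es_def)
qed


section \<open>The traversal is a reading\<close>

text \<open>Links the counting of letters to partners of ends: as the ends read are distinct, a
  letter is counted once for each of its two ends among them.\<close>

lemma count_edge_eq_1_iff:
  assumes A: "rooted_map A" and ds: "distinct ds" "set ds \<subseteq> ends A" and d: "d \<in> set ds"
  shows "count_list (word_of_ends A ds) (edge_of A d) = 1 \<longleftrightarrow> opp A d \<notin> set ds"
proof -
  let ?F = "filter (\<lambda>x. edge_of A d = edge_of A x) ds"
  have dA: "d \<in> ends A" using ds d by blast
  have "set ?F = {d, opp A d} \<inter> set ds"
    using edge_of_eq_iff[OF A dA] ds(2) dA by auto
  moreover have "count_list (word_of_ends A ds) (edge_of A d) = card (set ?F)"
    using distinct_card[of ?F] ds(1)
    by (simp add: word_of_ends_def count_list_eq_length_filter filter_map comp_def)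
  ultimately have "count_list (word_of_ends A ds) (edge_of A d) = card ({d, opp A d} \<inter> set ds)"
    by simp
  also have "{d, opp A d} \<inter> set ds = (if opp A d \<in> set ds then {d, opp A d} else {d})"
    using d by auto
  also have "card \<dots> = (if opp A d \<in> set ds then 2 else 1)"
    using opp_neq[OF A dA] by (auto dest: sym)
  finally show ?thesis by simp
qed

lemma leftmost_single_nth:
  assumes A: "rooted_map A" and ds: "distinct ds" "set ds \<subseteq> ends A"
    and ex: "\<exists>d \<in> set ds. opp A d \<notin> set ds"
  obtains a where "a < length ds" "leftmost_single A ds = ds ! a" "opp A (ds ! a) \<notin> set ds"
    "\<And>a'. a' < a \<Longrightarrow> opp A (ds ! a') \<in> set ds"
proof -
  let ?P = "\<lambda>d. count_list (word_of_ends A ds) (edge_of A d) = 1"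
  note P = count_edge_eq_1_iff[OF A ds]
  obtain d where d: "List.find ?P ds = Some d"
    using ex P by (cases "List.find ?P ds") (auto simp: find_None_iff)
  then obtain a where a: "a < length ds" "?P (ds ! a)" "d = ds ! a" "\<forall>a'<a. \<not> ?P (ds ! a')"
    unfolding find_Some_iff by blast
  show thesis
  proof (rule that[of a])
    show "leftmost_single A ds = ds ! a" using d a by (simp add: leftmost_single_def)
    show "opp A (ds ! a) \<notin> set ds" using a P[of "ds ! a"] by simp
    show "opp A (ds ! a') \<in> set ds" if "a' < a" for a' using a P[of "ds ! a'"] that by simp
  qed (rule a)
qed

text \<open>The assumption \<open>loop\<close> expresses the effect of \<alpha>: the partner of
  \<open>r\<close> comes last when the vertex is read from \<open>r\<close>, so the first block is a
  proper block. The invariant is \<open>block_reading\<close>, and the number of unread ends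
  decreases.\<close>

lemma traversal_reading:
  assumes A: "rooted_map A" and r: "root_end A = Some r" and loop: "ccw A (opp A r) = r"
  shows "block_reading A (traversal A) \<and> set (traversal A) = ends A"
proof -
  let ?P = "\<lambda>ds. block_reading A ds \<and> ds \<noteq> []"
  have rA: "r \<in> ends A" using root_in[OF A r] .
  have oA: "opp A r \<in> ends A" using opp_in[OF A rA] .
  have ne: "ends A \<noteq> {}" using rA by blast
  have sub: "distinct ds" "set ds \<subseteq> ends A" if "block_reading A ds" for ds
    using that by (auto simp: block_reading_def partial_reading_def)
  have start: "?P (read_from A r)"
  proof -
    have rf: "read_from A r = read_after A (opp A r)"
      using read_from_ccw[OF A oA] loop by simp
    have empty: "block_reading A []"
      by (simp add: block_reading_def partial_reading_def block_end_def is_block_def)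
    note es = read_after[OF A oA]
    \<comment> \<open>The first block contains \<open>r\<close> and its partner, so position
      \<open>0\<close> lies strictly before its end.\<close>
    have "read_after A (opp A r) \<noteq> [opp A r]"
    proof
      assume "read_after A (opp A r) = [opp A r]"
      then have "r = opp A r" using es(5) loop by simp
      then show False using opp_neq[OF A rA] by simp
    qed
    then have "length (read_after A (opp A r)) \<noteq> 1"
      using es(3,4) by (metis One_nat_def append_butlast_last_id append_self_conv2 length_0_conv length_butlast diff_Suc_1)
    then have "Suc 0 < length (read_after A (opp A r))"
      using es(3) by (simp add: nat_neq_iff)
    then have "block_reading A ([] @ read_after A (opp A r))"
      using es(5) loop r oA by (intro block_reading_append[OF A empty, of _ 0]) auto
    then show ?thesis using rf es(3) by simp
  qed
  have step: "?P (visit_next A ds) \<and>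
      card (ends A) - length (visit_next A ds) < card (ends A) - length ds"
    if ds: "?P ds" and cont: "vert A ` set ds \<noteq> verts A" for ds
  proof -
    note sub_ds = sub[OF conjunct1[OF ds]]
    have "vert A ` set ds \<subseteq> verts A" using sub_ds vert_in[OF A] by blast
    moreover have "vert A (hd ds) \<in> vert A ` set ds" using ds by simp
    ultimately obtain d where d: "d \<in> ends A" "vert A d \<in> vert A ` set ds"
      "vert A (opp A d) \<notin> vert A ` set ds"
      using exists_leaving_end[OF A] cont by metis
    \<comment> \<open>The vertex of \<open>d\<close> is visited, hence read completely, while the
      other end of the edge is unread; so a letter occurring once exists.\<close>
    have "d \<in> set ds" using ds d unfolding block_reading_def by blast
    moreover have "opp A d \<notin> set ds" using d by blast
    ultimately obtain a where a: "a < length ds" "leftmost_single A ds = ds ! a"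
      "opp A (ds ! a) \<notin> set ds" "\<And>a'. a' < a \<Longrightarrow> opp A (ds ! a') \<in> set ds"
      using leftmost_single_nth[OF A sub_ds] by blast
    let ?x = "opp A (ds ! a)"
    have x: "?x \<in> ends A" using opp_in[OF A] sub_ds a(1) nth_mem by blast
    have vn: "visit_next A ds = ds @ read_after A ?x"
      by (simp add: visit_next_def a(2))
    have len: "length (read_after A ?x) > 0" using read_after(3)[OF A x] by simp
    have len_a: "Suc a < length (ds @ read_after A ?x)"
      using a(1) len unfolding length_append by linarith
    have br: "block_reading A (ds @ read_after A ?x)"
      by (rule block_reading_append[OF A conjunct1[OF ds] x a(3), of a])
        (use ds a len_a in \<open>auto simp: nth_append\<close>)
    have "length (ds @ read_after A ?x) \<le> card (ends A)"
      using sub[OF br] by (metis A card_mono distinct_card finite_ends)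
    then have "card (ends A) - length (visit_next A ds) < card (ends A) - length ds"
      using len unfolding vn length_append by linarith
    then show ?thesis using br vn ds by simp
  qed
  have "?P (traversal A) \<and> vert A ` set (traversal A) = verts A"
    unfolding traversal_def r option.sel
    by (rule while_rule[where P = ?P and r = "measure (\<lambda>ds. card (ends A) - length ds)"])
      (use start step in auto)
  \<comment> \<open>On exit all vertices are visited, and visited vertices are read
    completely.\<close>
  moreover have "set ds = ends A" if "block_reading A ds" "vert A ` set ds = verts A" for ds
    using that sub(2)[OF that(1)] vert_in[OF A] unfolding block_reading_def by blast
  ultimately show ?thesis by blast
qed

lemma reading_eq_traversal:
  assumes "rooted_map A" "root_end A = Some r" "ccw A (opp A r) = r" "reading A L"
  shows "traversal A = L"
  using traversal_reading[OF assms(1-3)] assms reading_unique[of A "traversal A" L]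
  by (simp add: reading_def block_reading_def)

section \<open>The map with the added loop\<close>

lemma ends_at_add_loop:
  "ends_at (add_loop M) v =
     (if v = root_vertex M then {LoopFirst, LoopLast} else {}) \<union> Old ` ends_at M v"
  by (auto simp: ends_at_def add_loop_def)

lemma add_loop_simps [simp]:
  "verts (add_loop M) = verts M"
  "ends (add_loop M) = {LoopFirst, LoopLast} \<union> Old ` ends M"
  "vert (add_loop M) (Old d) = vert M d"
  "vert (add_loop M) LoopFirst = root_vertex M"
  "vert (add_loop M) LoopLast = root_vertex M"
  "opp (add_loop M) (Old d) = Old (opp M d)"
  "opp (add_loop M) LoopFirst = LoopLast"
  "opp (add_loop M) LoopLast = LoopFirst"
  "ccw (add_loop M) (Old d) = (if root_end M = Some (ccw M d) then LoopLast else Old (ccw M d))"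
  "ccw (add_loop M) LoopFirst = (case root_end M of None \<Rightarrow> LoopLast | Some r \<Rightarrow> Old r)"
  "ccw (add_loop M) LoopLast = LoopFirst"
  "root_end (add_loop M) = Some LoopFirst"
  by (simp_all add: add_loop_def)

lemma rooted_map_add_loop:
  assumes M: "rooted_map M"
  shows "rooted_map (add_loop M)"
proof -
  have cyc: "cyclic_on (ccw (add_loop M)) (ends_at (add_loop M) v)"
    if v: "v \<in> verts M" "ends_at (add_loop M) v \<noteq> {}" for v
  proof (cases "v = root_vertex M")
    case False
    then have eq: "ends_at (add_loop M) v = Old ` ends_at M v"
      by (simp add: ends_at_add_loop)
    then obtain d where d: "d \<in> ends M" "vert M d = v" using v by (auto simp: ends_at_def)
    \<comment> \<open>Away from the root vertex no successor is the root, so none is redirected to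
      \<open>LoopLast\<close>.\<close>
    have "ccw (add_loop M) (Old e) = Old (ccw M e)" if e: "e \<in> ends_at M v" for e
    proof -
      have "vert M (ccw M e) = v" using vert_ccw[OF M, of e] e by (simp add: ends_at_def)
      then have "root_end M \<noteq> Some (ccw M e)" using False by (auto simp: root_vertex_def)
      then show ?thesis by simp
    qed
    then show ?thesis
      unfolding eq using cyclic_ends_at[OF M d(1)] d(2) by (intro cyclic_on_image) auto
  next
    case True
    show ?thesis
    proof (cases "root_end M")
      case None
      then have "ends M = {}" using ends_empty_iff[OF M] by simp
      then have eq: "ends_at (add_loop M) v = set [LoopFirst, LoopLast]"
        using True by (simp add: ends_at_add_loop) (simp add: ends_at_def)
      show ?thesis
        unfolding eq by (rule cyclic_on_listI) (use None in \<open>auto simp: less_Suc_eq\<close>)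
    next
      case (Some r)
      then have r: "r \<in> ends M" "v = vert M r"
        using root_in[OF M] True by (auto simp: root_vertex_def)
      define n where "n = degree_at M r"
      define xs where "xs = map (\<lambda>i. (ccw M ^^ i) r) [0..<n]"
      note xs = ends_at_list[OF M r(1), folded n_def, folded xs_def]
      have n: "n > 0" using degree_at_pos[OF M r(1)] by (simp add: n_def)
      have len: "length xs = n" by (simp add: xs_def)
      have nth: "xs ! i = (ccw M ^^ i) r" if "i < n" for i using that by (simp add: xs_def)
      have xs0: "xs ! 0 = r" using n by (simp add: nth)
      \<comment> \<open>The rotation at the root vertex, cut open just before the root and enclosed
        by the two loop ends.\<close>
      let ?ys = "LoopFirst # map Old xs @ [LoopLast]"
      have step: "ccw M (xs ! i) = (if Suc i = n then r else xs ! Suc i)" if "i < n" for i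
        using that xs(3) nth[of "Suc i"] nth[of i] by auto
      \<comment> \<open>Only the last old end has the root as successor, so only there
        \<open>LoopLast\<close> is inserted.\<close>
      have ne: "xs ! Suc i \<noteq> r" if "Suc i < n" for i
        using nth_eq_iff_index_eq[OF xs(1), of "Suc i" 0] that len xs0 by simp
      have "cyclic_on (ccw (add_loop M)) (set ?ys)"
      proof (rule cyclic_on_listI)
        fix i assume i: "Suc i < length ?ys"
        show "ccw (add_loop M) (?ys ! i) = ?ys ! Suc i"
        proof (cases i)
          case 0
          then show ?thesis using Some xs0 n len by (simp add: nth_append)
        next
          case (Suc j)
          then have "j < n" using i len by simp
          then show ?thesis using Suc Some step[of j] ne[of j] len by (auto simp: nth_append)
        qed
      qed auto
      moreover have "set ?ys = ends_at (add_loop M) v"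
        using xs(2) True r by (auto simp: ends_at_add_loop)
      ultimately show ?thesis by simp
    qed
  qed
  let ?R = "\<lambda>M. {(vert M d, vert M (opp M d)) | d. d \<in> ends M}"
  have "?R M \<subseteq> ?R (add_loop M)"
  proof
    fix p assume "p \<in> ?R M"
    then obtain d where "d \<in> ends M" "p = (vert M d, vert M (opp M d))" by blast
    then show "p \<in> ?R (add_loop M)" by (intro CollectI exI[of _ "Old d"]) simp
  qed
  then have "connected_graph (add_loop M)"
    using M rtrancl_mono[of "?R M" "?R (add_loop M)"]
    unfolding rooted_map_def connected_graph_def add_loop_simps(1) by blast
  then show ?thesis
    unfolding rooted_map_def
    using cyc finite_ends[OF M] finite_verts[OF M] root_vertex_in[OF M] vert_in[OF M] opp_in[OF M]
      opp_neq[OF M] opp_opp[OF M]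
    by auto
qed

lemma traversal_add_loop:
  assumes "rooted_map M"
  shows "block_reading (add_loop M) (traversal (add_loop M))"
    and "reading (add_loop M) (traversal (add_loop M))"
  using traversal_reading[OF rooted_map_add_loop[OF assms], of LoopFirst]
  by (auto simp: reading_def block_reading_def)

lemma traversal_add_loop_eqI:
  "rooted_map M \<Longrightarrow> reading (add_loop M) L \<Longrightarrow> traversal (add_loop M) = L"
  by (rule reading_eq_traversal[OF rooted_map_add_loop, where r = LoopFirst]) simp_all


section \<open>Isomorphic maps and equal matchings\<close>

text \<open>The bijection on vertices comes for free, because vertices are the orbits of \<open>ccw\<close>.\<close>

lemma isomorphicI:
  assumes M: "rooted_map M" and N: "rooted_map N" and h: "bij_betw h (ends M) (ends N)"
    and opp: "\<And>d. d \<in> ends M \<Longrightarrow> opp N (h d) = h (opp M d)"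
    and ccw: "\<And>d. d \<in> ends M \<Longrightarrow> ccw N (h d) = h (ccw M d)"
    and root: "root_end N = map_option h (root_end M)"
  shows "isomorphic M N"
proof (cases "ends M = {}")
  case True
  then have "ends N = {}" using h by (simp add: bij_betw_def)
  then have "bij_betw (\<lambda>_. the_elem (verts N)) (verts M) (verts N)"
    using verts_eq_singleton[OF M True] verts_eq_singleton[OF N]
    by (metis bij_betw_singletonI)
  then show ?thesis
    unfolding isomorphic_def using True h root by blast
next
  case False
  have hN: "h d \<in> ends N" if "d \<in> ends M" for d using h that by (auto simp: bij_betw_def)
  have img: "h ` ends_at M (vert M d) = ends_at N (vert N (h d))" if d: "d \<in> ends M" for d
  proof -
    have "h ` orbit (ccw M) d = orbit (ccw N) (h d)"
    proof (rule orbit_inverse)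
      show "d \<in> orbit (ccw M) d" using ends_at_eq_orbit[OF M d] d by (auto simp: ends_at_def)
      show "ccw N (h x) = h (ccw M x)" if "x \<in> orbit (ccw M) d" for x
        using that ends_at_eq_orbit[OF M d] ccw by (auto simp: ends_at_def)
    qed
    then show ?thesis using ends_at_eq_orbit[OF M d] ends_at_eq_orbit[OF N hN[OF d]] by simp
  qed
  \<comment> \<open>Ends share a vertex iff they lie in the same orbit of \<open>ccw\<close>, and
    \<open>h\<close> maps orbits onto orbits.\<close>
  have key: "vert N (h d) = vert N (h e) \<longleftrightarrow> vert M d = vert M e"
    if "d \<in> ends M" "e \<in> ends M" for d e
  proof -
    have "vert N (h d) = vert N (h e) \<longleftrightarrow> h e \<in> h ` ends_at M (vert M d)"
      using img[OF that(1)] hN that by (auto simp: ends_at_def)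
    also have "\<dots> \<longleftrightarrow> e \<in> ends_at M (vert M d)"
      using h that by (intro inj_on_image_mem_iff[of _ "ends M"]) (auto simp: bij_betw_def ends_at_def)
    finally show ?thesis using that by (auto simp: ends_at_def)
  qed
  define c where "c v = (SOME d. d \<in> ends M \<and> vert M d = v)" for v
  have c: "c (vert M d) \<in> ends M" "vert M (c (vert M d)) = vert M d" if "d \<in> ends M" for d
    using someI[of "\<lambda>e. e \<in> ends M \<and> vert M e = vert M d" d] that by (auto simp: c_def)
  define f where "f v = vert N (h (c v))" for v
  have f: "f (vert M d) = vert N (h d)" if "d \<in> ends M" for d
    using key[of "c (vert M d)" d] c that by (simp add: f_def)
  have vM: "verts M = vert M ` ends M" using verts_eq_vert_ends[OF M False] .
  have "ends N \<noteq> {}" using False hN by blast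
  then have vN: "verts N = vert N ` h ` ends M"
    using verts_eq_vert_ends[OF N] h by (simp add: bij_betw_def)
  have "bij_betw f (verts M) (verts N)"
    unfolding bij_betw_def
  proof
    show "inj_on f (verts M)"
      unfolding vM by (rule inj_onI) (auto simp: f key)
    show "f ` verts M = verts N"
      unfolding vM vN image_image by (rule image_cong) (simp_all add: f)
  qed
  then show ?thesis
    unfolding isomorphic_def using h opp ccw f root
    by (intro exI[of _ f] exI[of _ h]) simp
qed

lemma matching_of_word_iff:
  assumes A: "rooted_map A" and L: "distinct L" "set L \<subseteq> ends A"
  shows "(a, b) \<in> matching_of_word (word_of_ends A L) \<longleftrightarrow>
    (\<exists>i j. a = Suc i \<and> b = Suc j \<and> i < j \<and> j < length L \<and> L ! j = opp A (L ! i))"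
proof -
  have key: "word_of_ends A L ! i = word_of_ends A L ! j \<longleftrightarrow> L ! j = opp A (L ! i)"
    if "i < j" "j < length L" for i j
  proof -
    have "L ! i \<in> ends A" "L ! j \<in> ends A" "L ! i \<noteq> L ! j"
      using that L by (auto simp: nth_eq_iff_index_eq intro: subsetD[OF L(2) nth_mem])
    then show ?thesis
      using that edge_of_eq_iff[OF A, of "L ! i" "L ! j"] by (auto simp: word_of_ends_def)
  qed
  have "(a, b) \<in> matching_of_word (word_of_ends A L) \<longleftrightarrow>
    (\<exists>i j. a = Suc i \<and> b = Suc j \<and> i < j \<and> j < length L \<and> word_of_ends A L ! i = word_of_ends A L ! j)"
    unfolding matching_of_word_def by (auto simp: word_of_ends_def)
  then show ?thesis by (simp add: key cong: conj_cong)
qed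

text \<open>In this form only the relation between positions of partner ends occurs, that is, the
  matching; hence readings with the same matching have the same block ends.\<close>

lemma block_end_iff_positions:
  "block_end A L b \<longleftrightarrow> b < length L \<and> (\<exists>a<b. L ! b = opp A (L ! a) \<and>
     (\<forall>a'<a. \<exists>c<b. L ! c = opp A (L ! a')))"
proof -
  have "x \<in> set (take b L) \<longleftrightarrow> (\<exists>c<b. L ! c = x)" if "b < length L" for x
    using that by (auto simp: in_set_conv_nth)
  then show ?thesis unfolding block_end_def by (simp cong: conj_cong)
qed

lemma map_with_loop_ends:
  "map_with_loop g ` ends (add_loop M) = {LoopFirst, LoopLast} \<union> Old ` g ` ends M"
  by (auto simp: image_Un image_image)

text \<open>The image of the traversal of \<open>M\<close> is a reading of \<open>N\<close>, hence
  its traversal, and an injective renaming of letters does not change the matching.\<close>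

lemma Phi_isomorphic:
  assumes M: "rooted_map M" and N: "rooted_map N" and iso: "isomorphic M N"
  shows "Phi M = Phi N"
proof -
  obtain f g where f: "bij_betw f (verts M) (verts N)" and g: "bij_betw g (ends M) (ends N)"
    and vert: "\<And>d. d \<in> ends M \<Longrightarrow> vert N (g d) = f (vert M d)"
    and opp: "\<And>d. d \<in> ends M \<Longrightarrow> opp N (g d) = g (opp M d)"
    and ccw: "\<And>d. d \<in> ends M \<Longrightarrow> ccw N (g d) = g (ccw M d)"
    and root: "root_end N = map_option g (root_end M)"
    using iso unfolding isomorphic_def by blast
  let ?A = "add_loop M" and ?B = "add_loop N" and ?g = "map_with_loop g"
  define L where "L = traversal ?A"
  note A = rooted_map_add_loop[OF M]
  note L = traversal_add_loop(2)[OF M, folded L_def]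
  have ginj: "g d = g e \<longleftrightarrow> d = e" if "d \<in> ends M" "e \<in> ends M" for d e
    using g that by (auto simp: bij_betw_def inj_on_eq_iff)
  have bij: "bij_betw ?g (ends ?A) (ends ?B)"
    using g unfolding bij_betw_def map_with_loop_ends
    by (auto simp: inj_on_def image_iff)
  \<comment> \<open>Shows that \<open>LoopLast\<close> is inserted behind corresponding ends of the
    two maps.\<close>
  have rootccw: "root_end N = Some (g (ccw M d)) \<longleftrightarrow> root_end M = Some (ccw M d)"
    if "d \<in> ends M" for d
    using root ginj root_in[OF M] ccw_in[OF M that] by (cases "root_end M") auto
  have "reading ?B (map ?g L)"
  proof (rule reading_map[OF L A bij])
    show "opp ?B (?g d) = ?g (opp ?A d)" if "d \<in> ends ?A" for d
      using that opp by auto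
    show "ccw ?B (?g d) = ?g (ccw ?A d)" if "d \<in> ends ?A" for d
      using that ccw rootccw root by (auto split: option.split)
  qed simp
  then have trav: "traversal ?B = map ?g L"
    using traversal_add_loop_eqI[OF N] by simp
  have edge: "edge_of ?B (?g d) = ?g ` edge_of ?A d" if "d \<in> ends ?A" for d
    using that opp by (auto simp: edge_of_def)
  have "word_of_ends ?B (map ?g L) = map ((`) ?g) (word_of_ends ?A L)"
    using edge readingD(2)[OF L] by (simp add: word_of_ends_def)
  moreover have "?g ` X = ?g ` Y \<longleftrightarrow> X = Y"
    if "X \<in> set (word_of_ends ?A L)" "Y \<in> set (word_of_ends ?A L)" for X Y
  proof (rule inj_on_image_eq_iff)
    show "inj_on ?g (ends ?A)" using bij by (simp add: bij_betw_def)
    show "X \<subseteq> ends ?A" "Y \<subseteq> ends ?A"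
      using that readingD(2)[OF L] opp_in[OF A] by (auto simp: word_of_ends_def edge_of_def)
  qed
  ultimately have "matching_of_word (word_of_ends ?B (map ?g L)) = matching_of_word (word_of_ends ?A L)"
    unfolding matching_of_word_def by (intro Collect_cong ex_cong1) auto
  then show ?thesis unfolding Phi_def trav L_def[symmetric] by simp
qed

text \<open>The isomorphism sends the end at each position of one traversal to the end at the same
  position of the other. It respects \<open>opp\<close> because the matchings agree, and
  \<open>ccw\<close> because the blocks then agree; removing the loop gives a bijection of the
  original ends.\<close>

lemma Phi_eq_imp_isomorphic:
  assumes M: "rooted_map M" and N: "rooted_map N" and eq: "Phi M = Phi N"
    and card: "card (ends M) = card (ends N)"
  shows "isomorphic M N"
proof -
  let ?A = "add_loop M" and ?B = "add_loop N"
  define L where "L = traversal ?A"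
  define L' where "L' = traversal ?B"
  note A = rooted_map_add_loop[OF M] and B = rooted_map_add_loop[OF N]
  note L = traversal_add_loop(2)[OF M, folded L_def]
  note L' = traversal_add_loop(2)[OF N, folded L'_def]
  note d = readingD(1)[OF L] readingD(1)[OF L']
  note s = readingD(2)[OF L] readingD(2)[OF L']
  have card_ends: "card (ends (add_loop X)) = card (ends X) + 2" if "rooted_map X" for X :: "('x, 'y) rmap"
    using finite_ends[OF that] by (simp add: card_insert_if card_image inj_on_def image_iff)
  have len: "length L = length L'"
    using card card_ends[OF M] card_ends[OF N] distinct_card[OF d(1)] distinct_card[OF d(2)]
    unfolding s by simp
  have in_ends: "L ! i \<in> ends ?A" "L' ! i \<in> ends ?B" if "i < length L" for i
    using that len s nth_mem[of i L] nth_mem[of i L'] by auto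
  have pair_less: "L ! j = opp ?A (L ! i) \<longleftrightarrow> L' ! j = opp ?B (L' ! i)"
    if "i < j" "j < length L" for i j
    using matching_of_word_iff[OF A d(1), of "Suc i" "Suc j"]
      matching_of_word_iff[OF B d(2), of "Suc i" "Suc j"] that eq len s
    by (simp add: Phi_def L_def L'_def)
  have pair: "L ! j = opp ?A (L ! i) \<longleftrightarrow> L' ! j = opp ?B (L' ! i)"
    if ij: "i < length L" "j < length L" for i j
  proof (cases i j rule: linorder_cases)
    case less then show ?thesis using pair_less ij by blast
  next
    case equal
    then show ?thesis using opp_neq[OF A] opp_neq[OF B] in_ends ij by metis
  next
    case greater
    have "L ! j = opp ?A (L ! i) \<longleftrightarrow> L ! i = opp ?A (L ! j)"
      "L' ! j = opp ?B (L' ! i) \<longleftrightarrow> L' ! i = opp ?B (L' ! j)"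
      using opp_opp[OF A] opp_opp[OF B] in_ends ij by metis+
    then show ?thesis using pair_less[OF greater ij(1)] by simp
  qed
  have be: "block_end ?A L b \<longleftrightarrow> block_end ?B L' b" for b
    unfolding block_end_iff_positions len[symmetric] by (simp add: pair cong: conj_cong)
  have blk: "is_block ?A L s b \<longleftrightarrow> is_block ?B L' s b" for s b
    unfolding is_block_def be ..
  define g where "g = the \<circ> map_of (zip L L')"
  have g: "g (L ! i) = L' ! i" if "i < length L" for i
    using map_of_zip_nth[OF len d(1)] that len by (simp add: g_def)
  have index: "\<exists>i<length L. x = L ! i" if "x \<in> ends ?A" for x
    using that s(1) by (metis in_set_conv_nth)
  have "map g L = L'"
    using g len by (intro nth_equalityI) auto
  then have bij: "bij_betw g (ends ?A) (ends ?B)"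
    unfolding bij_betw_def s[symmetric] using d(2) distinct_map[of g L] by auto
  have gopp: "g (opp ?A x) = opp ?B (g x)" if x: "x \<in> ends ?A" for x
  proof -
    obtain i j where "i < length L" "x = L ! i" "j < length L" "opp ?A x = L ! j"
      using index[OF x] index[OF opp_in[OF A x]] by blast
    then show ?thesis using pair[of i j] g by metis
  qed
  have gccw: "g (ccw ?A x) = ccw ?B (g x)" if x: "x \<in> ends ?A" for x
  proof -
    obtain i where i: "i < length L" "x = L ! i" using index[OF x] by blast
    show ?thesis
    proof (cases "block_end ?A L i")
      case True
      then obtain s where s: "is_block ?A L s i" using is_block_ex by blast
      then have "s < length L" using i by (simp add: is_block_def)
      then show ?thesis
        using readingD(6)[OF L s] readingD(6)[OF L', of s i] s blk i g by metis
    next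
      case False
      \<comment> \<open>The last position ends a block, so a position that does not has a
        successor.\<close>
      have "Suc i < length L"
      proof (rule ccontr)
        assume "\<not> Suc i < length L"
        then have "i = length L - 1" using i by simp
        moreover have "L \<noteq> []" using i by auto
        ultimately show False
          using False traversal_add_loop(1)[OF M, folded L_def] by (auto simp: block_reading_def)
      qed
      then show ?thesis
        using readingD(5)[OF L _ False] readingD(5)[OF L', of i] False be i g len by metis
    qed
  qed
  have "L \<noteq> []" "L' \<noteq> []" using s by auto
  \<comment> \<open>Both readings start with the same loop end, so \<open>g\<close> fixes both loop
    ends and restricts to the old ends.\<close>
  then have "L ! 0 = LoopFirst" "L' ! 0 = LoopFirst"
    using readingD(3)[OF L] readingD(3)[OF L'] by simp_all
  then have gF: "g LoopFirst = LoopFirst" using g[of 0] \<open>L \<noteq> []\<close> by simp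
  then have gL: "g LoopLast = LoopLast" using gopp[of LoopFirst] by simp
  define h where "h x = (case g (Old x) of Old e \<Rightarrow> e)" for x
  have ginj: "inj_on g (ends ?A)" using bij by (simp add: bij_betw_def)
  have h: "g (Old x) = Old (h x)" if x: "x \<in> ends M" for x
  proof -
    have "g (Old x) \<noteq> g LoopFirst" "g (Old x) \<noteq> g LoopLast"
      using inj_on_eq_iff[OF ginj] x by auto
    then show ?thesis unfolding h_def gF gL by (cases "g (Old x)") auto
  qed
  have img: "g ` ends ?A = ends ?B" using bij by (simp add: bij_betw_def)
  have "bij_betw h (ends M) (ends N)"
    unfolding bij_betw_def
  proof
    show "inj_on h (ends M)"
    proof (rule inj_onI)
      fix x y assume "x \<in> ends M" "y \<in> ends M" "h x = h y"
      then have "g (Old x) = g (Old y)" using h by simp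
      then show "x = y" using inj_on_eq_iff[OF ginj, of "Old x" "Old y"] \<open>x \<in> _\<close> \<open>y \<in> _\<close> by simp
    qed
    have "Old ` h ` ends M = g ` Old ` ends M" using h by (force simp: image_image)
    then have "{LoopFirst, LoopLast} \<union> Old ` h ` ends M = {LoopFirst, LoopLast} \<union> Old ` ends N"
      using img gF gL by simp
    then have "y \<in> h ` ends M \<longleftrightarrow> y \<in> ends N" for y
      by (auto simp: set_eq_iff dest: spec[of _ "Old y"])
    then show "h ` ends M = ends N" by blast
  qed
  moreover have "opp N (h x) = h (opp M x)" if x: "x \<in> ends M" for x
    using gopp[of "Old x"] h[OF x] h[OF opp_in[OF M x]] x by simp
  \<comment> \<open>The root is the successor of \<open>LoopFirst\<close>; it is absent when that
    successor is \<open>LoopLast\<close>.\<close>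
  moreover have root: "root_end N = map_option h (root_end M)"
    using gccw[of LoopFirst] gF gL h root_in[OF M] by (auto split: option.splits)
  moreover have "ccw N (h x) = h (ccw M x)" if x: "x \<in> ends M" for x
    using gccw[of "Old x"] h[OF x] h[OF ccw_in[OF M x]] x root gL
    by (auto split: if_splits)
  ultimately show ?thesis by (intro isomorphicI[OF M N]) auto
qed


section \<open>Connectedness and weight of the matching\<close>

definition unnested_edges :: "(nat \<times> nat) set \<Rightarrow> (nat \<times> nat) set" where
  "unnested_edges E = {e \<in> E. \<not> (\<exists>e' \<in> E. nests_edge e' e)}"

section \<open>Complete matchings, their unnested edges and their weight\<close>

context
  fixes m :: nat and E :: "(nat \<times> nat) set"
  assumes E: "complete_matching m E"
begin

lemma matching_less: "(a, b) \<in> E \<Longrightarrow> a < b"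
  using E by (auto simp: complete_matching_def)

lemma matching_Union: "(\<Union>(a, b) \<in> E. {a, b}) = {1..2 * m}"
  using E by (auto simp: complete_matching_def partition_on_def)

lemma matching_in_range: "(a, b) \<in> E \<Longrightarrow> 1 \<le> a \<and> b \<le> 2 * m"
  using matching_Union by fastforce

lemma finite_matching: "finite E"
proof (rule finite_subset)
  show "E \<subseteq> {1..2 * m} \<times> {1..2 * m}"
    using matching_in_range matching_less by fastforce
qed simp

text \<open>The partition consists of unordered pairs; \<open>a < b\<close> recovers the ordered
  edge from its pair.\<close>

lemma matching_eqI:
  assumes "(a, b) \<in> E" "(a', b') \<in> E" "{a, b} \<inter> {a', b'} \<noteq> {}"
  shows "a = a' \<and> b = b'"
proof -
  have disj: "disjoint ((\<lambda>(a, b). {a, b}) ` E)"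
    using E by (simp add: complete_matching_def partition_on_def)
  have mem: "{a, b} \<in> (\<lambda>(a, b). {a, b}) ` E" "{a', b'} \<in> (\<lambda>(a, b). {a, b}) ` E"
    using assms(1,2) by force+
  have "{a, b} = {a', b'}"
    by (rule ccontr) (use disjointD[OF disj mem] assms(3) in blast)
  then show ?thesis
    using matching_less assms(1,2) by (metis doubleton_eq_iff order_less_asym)
qed

lemma matching_covers:
  assumes "1 \<le> v" "v \<le> 2 * m"
  obtains w where "(v, w) \<in> E \<or> (w, v) \<in> E"
proof -
  have "v \<in> (\<Union>(a, b) \<in> E. {a, b})" using assms unfolding matching_Union by simp
  then show thesis using that by blast
qed

text \<open>The edge at vertex \<open>1\<close> cannot be nested, since no edge starts earlier. It
  is the one unnested edge of weight \<open>1\<close>, whence the \<open>- 1\<close>.\<close>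

lemma matching_weight_eq:
  assumes "m \<ge> 1"
  shows "unnested_edges E \<noteq> {}"
    and "matching_weight E = weight_c ^ (card (unnested_edges E) - 1)"
proof -
  obtain w where w: "(1, w) \<in> E"
    using matching_covers[of 1] matching_less matching_in_range assms
    by (metis One_nat_def le_less_trans less_irrefl_nat mult_2 nat_le_iff_add order_refl trans_le_add1)
  have U: "(1, w) \<in> unnested_edges E"
    using w matching_in_range by (fastforce simp: unnested_edges_def nests_edge_def)
  then show "unnested_edges E \<noteq> {}" by blast
  have one: "1 \<in> {fst e, snd e} \<longleftrightarrow> e = (1, w)" if "e \<in> E" for e
    using matching_eqI[OF w, of "fst e" "snd e"] that by (cases e) auto
  have fin: "finite (unnested_edges E)"
    using finite_matching by (simp add: unnested_edges_def)
  have "edge_weight E e = (if e \<in> unnested_edges E - {(1, w)} then weight_c else 1)" if "e \<in> E" for e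
    using that one[OF that] by (simp add: edge_weight_def unnested_edges_def)
  then have "matching_weight E = (\<Prod>e\<in>E. if e \<in> unnested_edges E - {(1, w)} then weight_c else 1)"
    unfolding matching_weight_def by (rule prod.cong[OF refl])
  also have "\<dots> = (\<Prod>e \<in> unnested_edges E - {(1, w)}. weight_c)"
    using finite_matching by (intro prod.mono_neutral_cong_right) (auto simp: unnested_edges_def)
  also have "\<dots> = weight_c ^ (card (unnested_edges E) - 1)"
    using U fin by simp
  finally show "matching_weight E = weight_c ^ (card (unnested_edges E) - 1)" .
qed

end

lemma weight_c_power_eq_iff: "weight_c ^ a = weight_c ^ b \<longleftrightarrow> a = b"
proof
  assume "weight_c ^ a = weight_c ^ b"
  then have "degree (weight_c ^ a) = degree (weight_c ^ b)" by simp
  then show "a = b" by (simp add: weight_c_def degree_power_eq)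
qed simp

section \<open>The connected matching of a reading\<close>

context
  fixes A :: "('v, 'd) rmap" and L :: "'d list" and m :: nat
  assumes A: "rooted_map A" and L: "reading A L" and len: "length L = 2 * m"
begin

lemma reading_in_ends: "i < length L \<Longrightarrow> L ! i \<in> ends A"
  using readingD(2)[OF L] nth_mem by blast

lemma reading_partner:
  assumes "i < length L"
  obtains j where "j < length L" "j \<noteq> i" "L ! j = opp A (L ! i)" "L ! i = opp A (L ! j)"
proof -
  have d: "L ! i \<in> ends A" using reading_in_ends[OF assms] .
  then have "opp A (L ! i) \<in> set L" using opp_in[OF A] readingD(2)[OF L] by simp
  then obtain j where "j < length L" "L ! j = opp A (L ! i)" by (metis in_set_conv_nth)
  then show thesis using that[of j] opp_neq[OF A d] opp_opp[OF A d] by metis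
qed

lemma reading_partner_unique:
  assumes "i < length L" "j < length L" "k < length L"
    and "L ! j = opp A (L ! i)" "L ! k = opp A (L ! i) \<or> L ! i = opp A (L ! k)"
  shows "k = j"
  using assms readingD(1)[OF L] opp_opp[OF A] reading_in_ends
  by (metis nth_eq_iff_index_eq)

lemma reading_matching_iff:
  "(a, b) \<in> matching_of_word (word_of_ends A L) \<longleftrightarrow>
    (\<exists>i j. a = Suc i \<and> b = Suc j \<and> i < j \<and> j < length L \<and> L ! j = opp A (L ! i))"
  using matching_of_word_iff[OF A readingD(1)[OF L]] readingD(2)[OF L] by simp

lemma reading_complete_matching: "complete_matching m (matching_of_word (word_of_ends A L))"
  unfolding complete_matching_def
proof
  let ?E = "matching_of_word (word_of_ends A L)"
  show "\<forall>(a, b) \<in> ?E. a < b" by (auto simp: reading_matching_iff)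
  show "partition_on {1..2 * m} ((\<lambda>(a, b). {a, b}) ` ?E)"
  proof (rule partition_onI)
    show "\<Union>((\<lambda>(a, b). {a, b}) ` ?E) = {1..2 * m}"
    proof (rule set_eqI, rule iffI)
      fix v assume "v \<in> \<Union>((\<lambda>(a, b). {a, b}) ` ?E)"
      then show "v \<in> {1..2 * m}" using len by (auto simp: reading_matching_iff)
    next
      fix v assume "v \<in> {1..2 * m}"
      then obtain i where i: "v = Suc i" "i < length L" using len by (cases v) auto
      obtain j where j: "j < length L" "j \<noteq> i" "L ! j = opp A (L ! i)" "L ! i = opp A (L ! j)"
        using reading_partner[OF i(2)] .
      then have "(Suc i, Suc j) \<in> ?E \<or> (Suc j, Suc i) \<in> ?E"
        using i by (auto simp: reading_matching_iff)
      then show "v \<in> \<Union>((\<lambda>(a, b). {a, b}) ` ?E)" using i by force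
    qed
    fix p q assume pq: "p \<in> (\<lambda>(a, b). {a, b}) ` ?E" "q \<in> (\<lambda>(a, b). {a, b}) ` ?E" "p \<noteq> q"
    obtain i j where p: "p = {Suc i, Suc j}" "i < j" "j < length L" "L ! j = opp A (L ! i)"
      using pq(1) by (auto simp: reading_matching_iff)
    obtain i' j' where q: "q = {Suc i', Suc j'}" "i' < j'" "j' < length L" "L ! j' = opp A (L ! i')"
      using pq(2) by (auto simp: reading_matching_iff)
    have ij: "i < length L" "i' < length L" "L ! i = opp A (L ! j)" "L ! i' = opp A (L ! j')"
      using p q opp_opp[OF A] reading_in_ends by auto
    have "i \<noteq> i'" "j \<noteq> j'" "i \<noteq> j'" "j \<noteq> i'"
      using pq(3) p q ij reading_partner_unique by (metis insert_commute)+
    then show "disjnt p q" unfolding p q by (auto simp: disjnt_def)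
  next
    show "{} \<notin> (\<lambda>(a, b). {a, b}) ` ?E" by auto
  qed
qed

text \<open>An end that is unmatched in the prefix of length \<open>i + 1\<close> belongs to an edge
  across the gap between positions \<open>i\<close> and \<open>i + 1\<close>.\<close>

lemma reading_unmatched:
  assumes "Suc i < length L"
  obtains a b where "a \<le> i" "i < b" "b < length L" "L ! b = opp A (L ! a)"
proof -
  obtain a where a: "a \<le> i" "opp A (L ! a) \<notin> set (take (Suc i) L)"
    using readingD(4)[OF L assms] by blast
  obtain b where b: "b < length L" "L ! b = opp A (L ! a)"
    using reading_partner[of a] a assms by (metis Suc_lessD le_less_trans)
  have "\<not> b < Suc i" using a b by (metis in_set_conv_nth length_take min_less_iff_conj nth_take)
  then show thesis using that[OF a(1) _ b] by simp
qed

text \<open>Take an edge across the gap to the right of the vertex. If it starts at the vertex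
  itself, an edge across the gap to the left cannot end there, because a position has only one
  partner; so that edge nests the vertex.\<close>

lemma reading_connected_matching: "connected_matching m (matching_of_word (word_of_ends A L))"
  unfolding connected_matching_def
proof (intro conjI ballI reading_complete_matching)
  fix v assume "v \<in> {1..2 * m} - {1, 2 * m}"
  then obtain i where i: "v = Suc (Suc i)" "Suc (Suc i) < length L"
    using len by (cases v; cases "v - 1") auto
  obtain a b where ab: "a \<le> Suc i" "Suc i < b" "b < length L" "L ! b = opp A (L ! a)"
    using reading_unmatched[of "Suc i"] i by blast
  obtain a1 b1 where ab1: "a1 \<le> i" "i < b1" "b1 < length L" "L ! b1 = opp A (L ! a1)"
    using reading_unmatched[of i] i by (metis Suc_lessD)
  have "\<exists>a b. a < Suc i \<and> Suc i < b \<and> b < length L \<and> L ! b = opp A (L ! a)"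
  proof (cases "a = Suc i")
    case True
    have "b1 \<noteq> Suc i"
    proof
      assume "b1 = Suc i"
      then have "a1 = b"
        using reading_partner_unique[of "Suc i" b a1] ab ab1 True i by simp
      then show False using ab ab1 by simp
    qed
    then show ?thesis using ab1 by (intro exI[of _ a1] exI[of _ b1]) simp
  next
    case False
    then show ?thesis using ab by (intro exI[of _ a] exI[of _ b]) simp
  qed
  then obtain a b where "a < Suc i" "Suc i < b" "b < length L" "L ! b = opp A (L ! a)" by blast
  then show "\<exists>e \<in> matching_of_word (word_of_ends A L). nests_vertex e v"
    using i(1) by (intro bexI[of _ "(Suc a, Suc b)"]) (auto simp: nests_vertex_def reading_matching_iff)
qed

text \<open>Nesting refers to the whole word, \<open>block_end\<close> only to a prefix. They agree
  because the partner of an end before \<open>a\<close> lies either before \<open>b\<close>, or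
  after \<open>b\<close> and then its edge nests the edge at \<open>a\<close> and
  \<open>b\<close>.\<close>

lemma block_end_iff_unnested:
  "block_end A L b \<longleftrightarrow> (\<exists>a. (Suc a, Suc b) \<in> unnested_edges (matching_of_word (word_of_ends A L)))"
proof
  assume "block_end A L b"
  then obtain a where a: "a < b" "b < length L" "L ! b = opp A (L ! a)"
    "\<forall>a'<a. \<exists>c<b. L ! c = opp A (L ! a')" unfolding block_end_iff_positions by blast
  have "\<not> nests_edge e' (Suc a, Suc b)" if e': "e' \<in> matching_of_word (word_of_ends A L)" for e'
  proof
    assume n: "nests_edge e' (Suc a, Suc b)"
    obtain a' b' where e: "e' = (Suc a', Suc b')" "a' < b'" "b' < length L" "L ! b' = opp A (L ! a')"
      using e' by (cases e') (auto simp: reading_matching_iff)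
    then have "a' < a" "b < b'" using n by (auto simp: nests_edge_def)
    then obtain c where "c < b" "L ! c = opp A (L ! a')" using a by blast
    then have "c = b'" using reading_partner_unique[of a' b' c] e a by auto
    then show False using \<open>c < b\<close> \<open>b < b'\<close> by simp
  qed
  then show "\<exists>a. (Suc a, Suc b) \<in> unnested_edges (matching_of_word (word_of_ends A L))"
    using a by (intro exI[of _ a]) (auto simp: unnested_edges_def reading_matching_iff)
next
  assume "\<exists>a. (Suc a, Suc b) \<in> unnested_edges (matching_of_word (word_of_ends A L))"
  then obtain a where a: "a < b" "b < length L" "L ! b = opp A (L ! a)"
    and un: "\<And>e'. e' \<in> matching_of_word (word_of_ends A L) \<Longrightarrow> \<not> nests_edge e' (Suc a, Suc b)"
    by (auto simp: unnested_edges_def reading_matching_iff)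
  have "\<exists>c<b. L ! c = opp A (L ! a')" if a': "a' < a" for a'
  proof -
    obtain c where c: "c < length L" "c \<noteq> a'" "L ! c = opp A (L ! a')" "L ! a' = opp A (L ! c)"
      using reading_partner[of a'] a a' by (metis less_trans)
    have "c \<noteq> b"
    proof
      assume "c = b"
      then have "a' = a" using reading_partner_unique[of b a a'] c a opp_opp[OF A] reading_in_ends a' by auto
      then show False using a' by simp
    qed
    moreover have "\<not> b < c"
    proof
      assume "b < c"
      then have "(Suc a', Suc c) \<in> matching_of_word (word_of_ends A L)"
        using c a a' by (auto simp: reading_matching_iff)
      then show False using un \<open>b < c\<close> a a' by (fastforce simp: nests_edge_def)
    qed
    ultimately show ?thesis using c by (intro exI[of _ c]) simp
  qed
  then show "block_end A L b" unfolding block_end_iff_positions using a by blast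
qed

text \<open>An unnested edge is sent to the vertex of its closing end: different blocks lie at
  different vertices, and each vertex is met by following its block to the end.\<close>

lemma card_unnested_edges:
  assumes blocks: "block_reading A L" and nonempty: "ends A \<noteq> {}"
  shows "card (unnested_edges (matching_of_word (word_of_ends A L))) = card (verts A)"
proof -
  let ?E = "matching_of_word (word_of_ends A L)"
  let ?f = "\<lambda>(a, b). vert A (L ! (b - 1))"
  have un: "\<exists>a b. e = (Suc a, Suc b) \<and> a < b \<and> b < length L \<and> L ! b = opp A (L ! a) \<and> block_end A L b"
    if "e \<in> unnested_edges ?E" for e
  proof -
    have "e \<in> ?E" using that by (simp add: unnested_edges_def)
    then obtain a b where "e = (Suc a, Suc b)" "a < b" "b < length L" "L ! b = opp A (L ! a)"
      by (cases e) (auto simp: reading_matching_iff)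
    then show ?thesis using that block_end_iff_unnested by blast
  qed
  have sep: "vert A (L ! b) \<noteq> vert A (L ! j)" if "block_end A L b" "b < j" "j < length L" for b j
    using blocks that unfolding block_reading_def by blast
  have "bij_betw ?f (unnested_edges ?E) (verts A)"
    unfolding bij_betw_def
  proof
    show "inj_on ?f (unnested_edges ?E)"
    proof (rule inj_onI)
      fix e e' assume e: "e \<in> unnested_edges ?E" "e' \<in> unnested_edges ?E" "?f e = ?f e'"
      obtain a b where ab: "e = (Suc a, Suc b)" "a < b" "b < length L" "L ! b = opp A (L ! a)" "block_end A L b"
        using un[OF e(1)] by blast
      obtain a' b' where ab': "e' = (Suc a', Suc b')" "a' < b'" "b' < length L" "L ! b' = opp A (L ! a')" "block_end A L b'"
        using un[OF e(2)] by blast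
      have "b = b'"
        using sep[OF ab(5), of b'] sep[OF ab'(5), of b] ab ab' e(3) by (cases b b' rule: linorder_cases) auto
      moreover have "a = a'"
        using opp_eq_iff[OF A, of "L ! a" "L ! a'"] nth_eq_iff_index_eq[OF readingD(1)[OF L], of a a']
          reading_in_ends ab ab' \<open>b = b'\<close> by simp
      ultimately show "e = e'" using ab ab' by simp
    qed
    show "?f ` unnested_edges ?E = verts A"
    proof (rule set_eqI, rule iffI)
      fix v assume "v \<in> ?f ` unnested_edges ?E"
      then obtain e where e: "e \<in> unnested_edges ?E" "v = ?f e" by blast
      then obtain b where "b < length L" "v = vert A (L ! b)" using un[OF e(1)] by auto
      then show "v \<in> verts A" using vert_in[OF A] reading_in_ends by simp
    next
      fix v assume v: "v \<in> verts A"
      have "v \<in> vert A ` set L"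
        using verts_eq_vert_ends[OF A nonempty] readingD(2)[OF L] v by simp
      then have "\<exists>i<length L. v = vert A (L ! i)" by (auto simp: in_set_conv_nth)
      then obtain i where i: "i < length L" "v = vert A (L ! i)" by blast
      have "block_end A L (length L - 1)"
        using blocks i unfolding block_reading_def by auto
      then have "\<exists>b\<ge>i. block_end A L b" using i by (intro exI[of _ "length L - 1"]) auto
      \<comment> \<open>Up to the next block end the reading follows \<open>ccw\<close>, which does
        not change the vertex.\<close>
      define b where "b = (LEAST b. i \<le> b \<and> block_end A L b)"
      have b: "i \<le> b" "block_end A L b" and least: "\<And>j. i \<le> j \<Longrightarrow> j < b \<Longrightarrow> \<not> block_end A L j"
        using LeastI_ex[OF \<open>\<exists>b\<ge>i. block_end A L b\<close>] not_less_Least unfolding b_def by blast+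
      have bl: "b < length L" using b(2) by (simp add: block_end_def)
      have "vert A (L ! (i + k)) = v" if "i + k \<le> b" for k
        using that
      proof (induction k)
        case (Suc k)
        then have "L ! Suc (i + k) = ccw A (L ! (i + k))"
          using readingD(5)[OF L, of "i + k"] least[of "i + k"] bl by simp
        then show ?case using Suc vert_ccw[OF A] reading_in_ends[of "i + k"] bl by simp
      qed (use i in simp)
      from this[of "b - i"] have "vert A (L ! b) = v" using b by simp
      moreover obtain a where "(Suc a, Suc b) \<in> unnested_edges ?E"
        using b(2) block_end_iff_unnested by blast
      ultimately show "v \<in> ?f ` unnested_edges ?E" by force
    qed
  qed
  then show ?thesis by (rule bij_betw_same_card)
qed

end

lemma
  assumes M: "rooted_map M"
  shows Phi_connected_matching: "connected_matching (card (edges M) + 1) (Phi M)"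
    and matching_weight_Phi: "matching_weight (Phi M) = map_weight M"
proof -
  let ?A = "add_loop M"
  note A = rooted_map_add_loop[OF M]
  note L = traversal_add_loop[OF M]
  have "card (ends ?A) = card (ends M) + 2"
    using finite_ends[OF M] by (simp add: card_insert_if card_image inj_on_def image_iff)
  then have len: "length (traversal ?A) = 2 * (card (edges M) + 1)"
    using distinct_card[OF readingD(1)[OF L(2)]] readingD(2)[OF L(2)] card_ends[OF M] by simp
  show conn: "connected_matching (card (edges M) + 1) (Phi M)"
    unfolding Phi_def by (rule reading_connected_matching[OF A L(2) len])
  then have "matching_weight (Phi M) = weight_c ^ (card (unnested_edges (Phi M)) - 1)"
    by (intro matching_weight_eq(2)) (auto simp: connected_matching_def)
  also have "card (unnested_edges (Phi M)) = card (verts ?A)"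
    unfolding Phi_def by (rule card_unnested_edges[OF A L(2) len L(1)]) simp
  finally show "matching_weight (Phi M) = map_weight M"
    using map_weight_eq[OF M] by simp
qed


section \<open>The map of a connected matching\<close>

text \<open>
  A connected matching as an involution without fixed points on the positions \<open>0, \<dots>, N - 1\<close>
  of a word.
\<close>

locale connected_involution =
  fixes N :: nat and \<pi> :: "nat \<Rightarrow> nat"
  assumes pos: "0 < N"
    and less: "i < N \<Longrightarrow> \<pi> i < N"
    and neq: "i < N \<Longrightarrow> \<pi> i \<noteq> i"
    and inv: "i < N \<Longrightarrow> \<pi> (\<pi> i) = i"
    and nested: "0 < i \<Longrightarrow> Suc i < N \<Longrightarrow> \<exists>a<i. i < \<pi> a"
begin

text \<open>The counterpart of \<open>block_end\<close> for bare positions, available before there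
  is a map.\<close>

definition closing :: "nat \<Rightarrow> bool" where
  "closing b \<longleftrightarrow> b < N \<and> (\<exists>a<b. \<pi> a = b \<and> (\<forall>a'<a. \<pi> a' < b))"

definition block_of :: "nat \<Rightarrow> nat" where
  "block_of i = (LEAST b. i \<le> b \<and> closing b)"

definition start :: "nat \<Rightarrow> nat" where
  "start b = (LEAST s. \<forall>t. s \<le> t \<longrightarrow> t < b \<longrightarrow> \<not> closing t)"

lemma inj: "i < N \<Longrightarrow> j < N \<Longrightarrow> \<pi> i = \<pi> j \<longleftrightarrow> i = j"
  using inv by metis

lemma closing_first: "closing (\<pi> 0)"
  using pos less[of 0] neq[of 0] by (auto simp: closing_def intro!: exI[of _ 0])

lemma first_pos: "0 < \<pi> 0"
  using pos neq[of 0] by simp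

lemma first_le: "closing b \<Longrightarrow> \<pi> 0 \<le> b"
  unfolding closing_def by (metis gr_zeroI less_imp_le order_refl)

lemma closing_last: "closing (N - 1)"
proof -
  let ?a = "\<pi> (N - 1)"
  have a: "?a < N" "?a \<noteq> N - 1" "\<pi> ?a = N - 1"
    using pos less[of "N - 1"] neq[of "N - 1"] inv[of "N - 1"] by simp_all
  have "\<pi> a' < N - 1" if "a' < ?a" for a'
  proof -
    have "a' < N" using that a by simp
    then have "\<pi> a' < N" "\<pi> a' \<noteq> \<pi> ?a" using less inj[of a' ?a] that a by auto
    then show ?thesis using a(3) by simp
  qed
  then show ?thesis using a pos unfolding closing_def by (intro conjI exI[of _ ?a]) auto
qed

lemma
  shows start_le: "start b \<le> b"
    and not_closing: "start b \<le> t \<Longrightarrow> t < b \<Longrightarrow> \<not> closing t"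
    and closing_start: "start b = 0 \<or> closing (start b - 1)"
proof -
  let ?P = "\<lambda>s. \<forall>t. s \<le> t \<longrightarrow> t < b \<longrightarrow> \<not> closing t"
  have "?P b" by simp
  then have P: "?P (start b)" "start b \<le> b"
    unfolding start_def by (rule LeastI[of ?P], rule Least_le[of ?P])
  then show "start b \<le> b" "start b \<le> t \<Longrightarrow> t < b \<Longrightarrow> \<not> closing t" by blast+
  show "start b = 0 \<or> closing (start b - 1)"
  proof (cases "start b")
    case (Suc s)
    then have "\<not> ?P s" using not_less_Least[of s ?P] by (simp add: start_def)
    then obtain t where "s \<le> t" "t < b" "closing t" by blast
    moreover from this have "t = s" using P(1) Suc by (metis not_less_eq_eq order_antisym)
    ultimately show ?thesis using Suc by simp
  qed simp
qed

lemma start_unique: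
  assumes "s \<le> b" "s = 0 \<or> closing (s - 1)" "\<And>t. s \<le> t \<Longrightarrow> t < b \<Longrightarrow> \<not> closing t"
  shows "start b = s"
proof (rule order_antisym)
  show "start b \<le> s" unfolding start_def using assms(3) by (intro Least_le) blast
  show "s \<le> start b"
  proof (rule ccontr)
    assume "\<not> s \<le> start b"
    then have "closing (s - 1)" "start b \<le> s - 1" "s - 1 < b" using assms by auto
    then show False using not_closing by blast
  qed
qed

lemma start_first: "start (\<pi> 0) = 0"
  using first_le by (intro start_unique) (auto simp: not_less[symmetric])

lemma first_less_start:
  assumes "closing b" "b \<noteq> \<pi> 0"
  shows "\<pi> 0 < start b"
  using not_closing[of b "\<pi> 0"] closing_first first_le[OF assms(1)] assms(2) by linarith

lemma
  assumes "i < N"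
  shows le_block_of: "i \<le> block_of i" and closing_block_of: "closing (block_of i)"
    and not_closing_block: "i \<le> t \<Longrightarrow> t < block_of i \<Longrightarrow> \<not> closing t"
proof -
  let ?P = "\<lambda>b. i \<le> b \<and> closing b"
  have "?P (N - 1)" using closing_last assms by auto
  then have "?P (block_of i)" unfolding block_of_def by (rule LeastI)
  then show "i \<le> block_of i" "closing (block_of i)" by auto
  show "i \<le> t \<Longrightarrow> t < block_of i \<Longrightarrow> \<not> closing t"
    using not_less_Least[of t ?P] by (auto simp: block_of_def)
qed

lemma block_of_eq_iff:
  assumes "i < N" "closing b"
  shows "block_of i = b \<longleftrightarrow> start b \<le> i \<and> i \<le> b"
proof
  assume eq: "block_of i = b"
  then have "start b \<le> i"
    unfolding start_def using not_closing_block[OF assms(1)] by (intro Least_le) blast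
  then show "start b \<le> i \<and> i \<le> b" using le_block_of[OF assms(1)] eq by simp
next
  assume i: "start b \<le> i \<and> i \<le> b"
  have "\<not> block_of i < b"
    using not_closing[of b "block_of i"] closing_block_of[OF assms(1)] le_block_of[OF assms(1)] i by auto
  moreover have "\<not> b < block_of i"
    using not_closing_block[OF assms(1), of b] assms(2) i by auto
  ultimately show "block_of i = b" by simp
qed

text \<open>The source of connectedness of the constructed map. The bounds on \<open>a\<close>
  ensure that the edge closing the block is an edge of the map and not the loop.\<close>

lemma opens_in_earlier_block:
  assumes b: "closing b" "b \<noteq> \<pi> 0"
  obtains a where "0 < a" "a < N" "a \<noteq> \<pi> 0" "\<pi> a = b" "block_of a < b"
proof -
  obtain a where a: "a < b" "\<pi> a = b" "\<And>a'. a' < a \<Longrightarrow> \<pi> a' < b" "b < N"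
    using b(1) by (auto simp: closing_def)
  define p where "p = start b - 1"
  have p: "closing p" "p < b" "0 < p"
    using first_less_start[OF b] closing_start[of b] start_le[of b] first_pos by (auto simp: p_def)
  obtain a1 where a1: "a1 < p" "p < \<pi> a1" using nested[of p] p a by auto
  \<comment> \<open>Here \<open>p\<close> ends the previous block and \<open>x\<close> is the
    leftmost position whose edge passes over it. Its partner is closing, hence not before
    \<open>b\<close>; as all positions before \<open>a\<close> have partners before
    \<open>b\<close>, it follows that \<open>a \<le> x < p\<close>.\<close>
  define x where "x = (LEAST x. p < \<pi> x)"
  have x: "p < \<pi> x" "x \<le> a1" "\<And>y. y < x \<Longrightarrow> \<not> p < \<pi> y"
    unfolding x_def
    by (rule LeastI[of "\<lambda>x. p < \<pi> x", OF a1(2)], rule Least_le, rule a1(2), rule not_less_Least)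
  have "closing (\<pi> x)"
    unfolding closing_def
    using x a1 less[of x] p a by (intro conjI exI[of _ x]) (auto, fastforce)
  then have "b \<le> \<pi> x"
    using not_closing[of b "\<pi> x"] x(1) by (fastforce simp: p_def)
  then have "a \<le> x" using a(3)[of x] by linarith
  then have "a \<le> p" using x(2) a1(1) by linarith
  moreover have aN: "a < N" using a by simp
  ultimately have "block_of a < b"
    using not_closing_block[OF aN, of p] p by (metis le_less_trans linorder_not_less)
  moreover have "0 < a" using b(2) a(2) by (metis gr_zeroI)
  moreover have "a \<noteq> \<pi> 0" using a(1,2) inv[of 0] pos by auto
  ultimately show thesis using that aN a(2) by blast
qed

text \<open>If the loop closed at once in a longer word, nothing could nest position
  \<open>1\<close>. This singles out the map without edges.\<close>

lemma first_eq_Suc_0_iff: "\<pi> 0 = Suc 0 \<longleftrightarrow> N = 2"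
proof
  assume "\<pi> 0 = Suc 0"
  then have "\<not> Suc (Suc 0) < N" using nested[of "Suc 0"] by auto
  then show "N = 2" using pos less[of 0] first_pos \<open>\<pi> 0 = Suc 0\<close> by simp
next
  assume "N = 2"
  then show "\<pi> 0 = Suc 0" using less[of 0] first_pos by simp
qed

text \<open>Positions \<open>0\<close> and \<open>\<pi> 0\<close> are reserved for \<alpha>; the
  others become ends of the map.\<close>

definition places :: "nat set" where
  "places = {i. 0 < i \<and> i < N \<and> i \<noteq> \<pi> 0}"

text \<open>The first block loses its outer positions to the loop, so its rotation closes up from
  \<open>\<pi> 0 - 1\<close> to \<open>1\<close>; every other block closes up from its end to its
  start.\<close>

definition turn :: "nat \<Rightarrow> nat" where
  "turn i = (if Suc i = \<pi> 0 then 1 else if closing i then start i else Suc i)"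

context
  fixes \<iota> :: "nat \<Rightarrow> 'd" and \<kappa> :: "nat \<Rightarrow> 'v"
  assumes \<iota>: "inj \<iota>" and \<kappa>: "inj \<kappa>"
begin

text \<open>Vertices are the blocks, named by their closing positions. The root is position
  \<open>1\<close>, directly behind \<open>LoopFirst\<close>. The injections \<open>\<iota>\<close>
  and \<open>\<kappa>\<close> move positions into the given types.\<close>

definition rmap_of :: "('v, 'd) rmap" where
  "rmap_of =
     \<lparr>verts = \<kappa> ` {b. closing b},
      ends = \<iota> ` places,
      vert = (\<lambda>d. \<kappa> (block_of (inv \<iota> d))),
      opp = (\<lambda>d. \<iota> (\<pi> (inv \<iota> d))),
      ccw = (\<lambda>d. \<iota> (turn (inv \<iota> d))),
      root_end = (if N = 2 then None else Some (\<iota> 1))\<rparr>"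

lemma rmap_of_simps [simp]:
  "verts rmap_of = \<kappa> ` {b. closing b}"
  "ends rmap_of = \<iota> ` places"
  "vert rmap_of (\<iota> i) = \<kappa> (block_of i)"
  "opp rmap_of (\<iota> i) = \<iota> (\<pi> i)"
  "ccw rmap_of (\<iota> i) = \<iota> (turn i)"
  "root_end rmap_of = (if N = 2 then None else Some (\<iota> 1))"
  using inv_f_f[OF \<iota>] by (simp_all add: rmap_of_def)

lemma partner_in_places: "i \<in> places \<Longrightarrow> \<pi> i \<in> places"
  using less[of i] inv[of i] inj[of i 0] pos by (auto simp: places_def intro: gr0I)

lemma cyclic_on_interval:
  assumes "s < e" "\<And>i. s \<le> i \<Longrightarrow> Suc i < e \<Longrightarrow> turn i = Suc i" "turn (e - 1) = s"
  shows "cyclic_on (ccw rmap_of) (\<iota> ` {s..<e})"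
proof -
  have "cyclic_on (ccw rmap_of) (set (map \<iota> [s..<e]))"
    by (rule cyclic_on_listI) (use assms in \<open>auto simp: last_map hd_map simp del: set_map\<close>)
  then show ?thesis by simp
qed

lemma cyclic_on_ends_at:
  assumes v: "v \<in> verts rmap_of" "ends_at rmap_of v \<noteq> {}"
  shows "cyclic_on (ccw rmap_of) (ends_at rmap_of v)"
proof -
  obtain b where b: "closing b" "v = \<kappa> b" using v by auto
  have bN: "b < N" using b by (simp add: closing_def)
  have ends: "ends_at rmap_of v = \<iota> ` {i \<in> places. start b \<le> i \<and> i \<le> b}"
    using block_of_eq_iff b inj_eq[OF \<kappa>] by (auto simp: ends_at_def places_def)
  show ?thesis
  proof (cases "b = \<pi> 0")
    case True
    \<comment> \<open>This interval may be empty, namely for the map without edges; the assumption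
      that \<open>v\<close> has ends excludes that.\<close>
    then have eq: "{i \<in> places. start b \<le> i \<and> i \<le> b} = {1..<\<pi> 0}"
      using start_first bN by (auto simp: places_def)
    then have "1 < \<pi> 0" using v(2) unfolding ends by auto
    then show ?thesis
      unfolding ends eq
      by (intro cyclic_on_interval) (auto simp: turn_def dest: first_le)
  next
    case False
    note st = first_less_start[OF b(1) False]
    have eq: "{i \<in> places. start b \<le> i \<and> i \<le> b} = {start b..<Suc b}"
      using st bN first_pos by (auto simp: places_def)
    show ?thesis
      unfolding ends eq
      using st start_le[of b] not_closing[of b] b(1)
      by (intro cyclic_on_interval) (auto simp: turn_def)
  qed
qed

text \<open>By induction on closing positions every block is reached from the first one, since the
  edge closing a block joins it to an earlier block; \<open>sym R\<close> gives the way
  back.\<close>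

lemma connected_rmap_of: "connected_graph rmap_of"
proof -
  define R where "R = {(vert rmap_of d, vert rmap_of (opp rmap_of d)) | d. d \<in> ends rmap_of}"
  have R: "(\<kappa> (block_of i), \<kappa> (block_of (\<pi> i))) \<in> R" if "i \<in> places" for i
    unfolding R_def using that by (intro CollectI exI[of _ "\<iota> i"]) auto
  have "sym R"
  proof (rule symI)
    fix v w assume "(v, w) \<in> R"
    then obtain i where i: "i \<in> places" "v = \<kappa> (block_of i)" "w = \<kappa> (block_of (\<pi> i))"
      by (auto simp: R_def)
    then show "(w, v) \<in> R" using R[OF partner_in_places[OF i(1)]] inv[of i] by (simp add: places_def)
  qed
  have reach: "(\<kappa> (\<pi> 0), \<kappa> b) \<in> R\<^sup>*" if "closing b" for b
    using that
  proof (induction b rule: less_induct)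
    case (less b)
    show ?case
    proof (cases "b = \<pi> 0")
      case False
      then obtain a where a: "0 < a" "a < N" "a \<noteq> \<pi> 0" "\<pi> a = b" "block_of a < b"
        using opens_in_earlier_block less.prems by metis
      have "b < N" using less.prems by (simp add: closing_def)
      then have "block_of b = b"
        using block_of_eq_iff less.prems start_le by simp
      then have "(\<kappa> (block_of a), \<kappa> b) \<in> R" using R[of a] a by (simp add: places_def)
      then show ?thesis
        using less.IH[OF a(5) closing_block_of[OF a(2)]] by (rule rtrancl_into_rtrancl[rotated])
    qed simp
  qed
  have "(v, w) \<in> R\<^sup>*" if vw: "v \<in> verts rmap_of" "w \<in> verts rmap_of" for v w
  proof -
    have "(\<kappa> (\<pi> 0), v) \<in> R\<^sup>*" "(\<kappa> (\<pi> 0), w) \<in> R\<^sup>*" using vw reach by auto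
    then show ?thesis using symD[OF sym_rtrancl[OF \<open>sym R\<close>]] by (meson rtrancl_trans)
  qed
  moreover have "verts rmap_of \<noteq> {}" using closing_first by auto
  ultimately show ?thesis unfolding connected_graph_def R_def by blast
qed

lemma rooted_rmap_of: "rooted_map rmap_of"
proof -
  have one: "1 \<in> places" if "N \<noteq> 2"
    using that first_eq_Suc_0_iff less[of 0] first_pos pos by (auto simp: places_def)
  have empty: "places = {}" if "N = 2"
    unfolding places_def using that first_eq_Suc_0_iff by auto
  have "finite {b. closing b}" by (rule finite_subset[of _ "{..<N}"]) (auto simp: closing_def)
  moreover have "finite places" by (rule finite_subset[of _ "{..<N}"]) (auto simp: places_def)
  moreover have "case root_end rmap_of of None \<Rightarrow> ends rmap_of = {} | Some r \<Rightarrow> r \<in> ends rmap_of"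
  proof (cases "N = 2")
    case True
    show ?thesis unfolding rmap_of_simps empty[OF True] using True by simp
  next
    case False
    then show ?thesis using one by simp
  qed
  ultimately show ?thesis
    unfolding rooted_map_def
    using cyclic_on_ends_at connected_rmap_of partner_in_places closing_block_of neq inv inj_eq[OF \<iota>]
    by (simp del: rmap_of_simps(6)) (auto simp: places_def)
qed

definition end_at :: "nat \<Rightarrow> 'd with_loop" where
  "end_at i = (if i = 0 then LoopFirst else if i = \<pi> 0 then LoopLast else Old (\<iota> i))"

lemma end_at_eq_iff: "end_at i = end_at j \<longleftrightarrow> i = j"
  using inj_eq[OF \<iota>] first_pos by (auto simp: end_at_def)

lemma opp_end_at: "i < N \<Longrightarrow> opp (add_loop rmap_of) (end_at i) = end_at (\<pi> i)"
proof -
  assume i: "i < N"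
  then have "\<pi> i = 0 \<longleftrightarrow> i = \<pi> 0" using inv[of 0] inv[of i] pos by metis
  then show ?thesis using inv[of 0] first_pos pos inj[OF i pos] by (auto simp: end_at_def)
qed

lemma block_end_end_at: "block_end (add_loop rmap_of) (map end_at [0..<N]) b \<longleftrightarrow> closing b"
  unfolding block_end_iff_positions closing_def
  by (auto simp: opp_end_at end_at_eq_iff cong: conj_cong)

lemma reading_rmap_of: "reading (add_loop rmap_of) (map end_at [0..<N])"
proof -
  let ?A = "add_loop rmap_of" and ?L = "map end_at [0..<N]"
  have "distinct ?L" by (simp add: distinct_map inj_on_def end_at_eq_iff)
  moreover have "set ?L = ends ?A"
  proof -
    have "{0..<N} = {0, \<pi> 0} \<union> places" using pos less[of 0] by (auto simp: places_def)
    moreover have "end_at ` places = Old ` \<iota> ` places"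
      unfolding image_image by (rule image_cong) (auto simp: places_def end_at_def)
    ultimately show ?thesis using first_pos by (simp add: image_Un) (simp add: end_at_def)
  qed
  moreover have "root_end ?A = Some (?L ! 0)" using pos by (simp add: end_at_def)
  moreover have "\<exists>a\<le>i. opp ?A (?L ! a) \<notin> set (take (Suc i) ?L)" if i: "Suc i < length ?L" for i
  proof -
    \<comment> \<open>Connectedness covers interior positions; at position \<open>0\<close> the loop
      itself is still open.\<close>
    have "\<exists>a\<le>i. i < \<pi> a"
      using nested[of i] i first_pos by (cases "i = 0") (auto intro: less_imp_le)
    then obtain a where a: "a \<le> i" "i < \<pi> a" by blast
    then have "\<pi> a < N" using less[of a] i by simp
    then have "opp ?A (?L ! a) = ?L ! \<pi> a" using a i by (simp add: opp_end_at)
    then show ?thesis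
      using nth_mem_take_iff[OF \<open>distinct ?L\<close>, of "\<pi> a" "Suc i"] a \<open>\<pi> a < N\<close> by (intro exI[of _ a]) simp
  qed
  moreover have "ccw ?A (?L ! i) = ?L ! Suc i" if i: "Suc i < length ?L" "\<not> closing i" for i
  proof (cases "i = 0")
    case True
    \<comment> \<open>\<open>LoopFirst\<close> is followed by the root at position \<open>1\<close>,
      or for \<open>N = 2\<close> by \<open>LoopLast\<close>, since then
      \<open>\<pi> 0 = 1\<close>.\<close>
    then show ?thesis using i first_eq_Suc_0_iff by (auto simp: end_at_def)
  next
    case False
    moreover have "i \<noteq> \<pi> 0" using i closing_first by auto
    moreover have "N \<noteq> 2" using i False by auto
    \<comment> \<open>If \<open>Suc i = \<pi> 0\<close>, then \<open>turn i\<close> is the root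
      position, so \<open>add_loop\<close> inserts \<open>LoopLast\<close> exactly at position
      \<open>\<pi> 0\<close>.\<close>
    ultimately show ?thesis using i inj_eq[OF \<iota>] by (auto simp: end_at_def turn_def)
  qed
  moreover have "ccw ?A (?L ! b) = ?L ! s" if blk: "is_block ?A ?L s b" for s b
  proof -
    have b: "closing b" "s \<le> b" using blk by (auto simp: is_block_def block_end_end_at)
    have s: "start b = s"
      using blk by (intro start_unique) (auto simp: is_block_def block_end_end_at)
    have bN: "b < N" using b by (simp add: closing_def)
    show ?thesis
    proof (cases "b = \<pi> 0")
      case True
      then show ?thesis using s start_first bN first_pos pos by (auto simp: end_at_def)
    next
      case False
      then show ?thesis
        using first_less_start[OF b(1) False] s b bN first_pos first_le[OF b(1)] inj_eq[OF \<iota>]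
        by (auto simp: end_at_def turn_def)
    qed
  qed
  ultimately show ?thesis
    unfolding reading_def partial_reading_def block_end_end_at by blast
qed

lemma Phi_rmap_of: "(a, b) \<in> Phi rmap_of \<longleftrightarrow> (\<exists>i. a = Suc i \<and> b = Suc (\<pi> i) \<and> i < \<pi> i \<and> i < N)"
proof -
  have "traversal (add_loop rmap_of) = map end_at [0..<N]"
    by (rule traversal_add_loop_eqI[OF rooted_rmap_of reading_rmap_of])
  moreover note matching_of_word_iff[OF rooted_map_add_loop[OF rooted_rmap_of]
      readingD(1)[OF reading_rmap_of], of a b]
  ultimately have "(a, b) \<in> Phi rmap_of \<longleftrightarrow>
      (\<exists>i j. a = Suc i \<and> b = Suc j \<and> i < j \<and> j < N \<and>
         map end_at [0..<N] ! j = opp (add_loop rmap_of) (map end_at [0..<N] ! i))"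
    using readingD(2)[OF reading_rmap_of] unfolding Phi_def by simp
  then show ?thesis
    using less by (auto simp: opp_end_at end_at_eq_iff cong: conj_cong)
qed

end

end


section \<open>The bijection\<close>

text \<open>Passes from ordered pairs of vertices counted from \<open>1\<close> to partners of
  positions counted from \<open>0\<close>; the vertices exempt from nesting become positions
  \<open>0\<close> and \<open>2 * m - 1\<close>.\<close>

lemma connected_matching_involution:
  assumes conn: "connected_matching m E" and "m \<ge> 1"
  obtains \<pi> where "connected_involution (2 * m) \<pi>"
    and "\<And>a b. (a, b) \<in> E \<longleftrightarrow> (\<exists>i. a = Suc i \<and> b = Suc (\<pi> i) \<and> i < \<pi> i \<and> i < 2 * m)"
proof -
  have E: "complete_matching m E" using conn by (simp add: connected_matching_def)
  note less = matching_less[OF E] and range = matching_in_range[OF E] and eqI = matching_eqI[OF E]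
  define P where "P i j \<longleftrightarrow> (Suc i, Suc j) \<in> E \<or> (Suc j, Suc i) \<in> E" for i j
  define \<pi> where "\<pi> i = (THE j. P i j)" for i
  have unique: "j = k" if "P i j" "P i k" for i j k
    using that eqI less unfolding P_def by blast
  have \<pi>_eqI: "\<pi> i = j" if "P i j" for i j
    unfolding \<pi>_def using that unique by blast
  have P: "P i (\<pi> i)" if i: "i < 2 * m" for i
  proof -
    obtain w where w: "(Suc i, w) \<in> E \<or> (w, Suc i) \<in> E"
      using matching_covers[OF E, of "Suc i"] i by auto
    then have "w \<noteq> 0" using less range by fastforce
    then have "P i (w - 1)" using w by (simp add: P_def)
    then show ?thesis using \<pi>_eqI by metis
  qed
  have lt: "j < 2 * m" "j \<noteq> i" "P j i" if "P i j" for i j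
    using that range less unfolding P_def by fastforce+
  have E_iff: "(a, b) \<in> E \<longleftrightarrow> (\<exists>i. a = Suc i \<and> b = Suc (\<pi> i) \<and> i < \<pi> i \<and> i < 2 * m)" for a b
  proof
    assume ab: "(a, b) \<in> E"
    then obtain i j where ij: "a = Suc i" "b = Suc j"
      using range[OF ab] less[OF ab] by (cases a; cases b) auto
    then have "P i j" using ab by (simp add: P_def)
    then show "\<exists>i. a = Suc i \<and> b = Suc (\<pi> i) \<and> i < \<pi> i \<and> i < 2 * m"
      using \<pi>_eqI[of i j] ij less[OF ab] lt(1)[OF lt(3)[of i j]] by auto
  next
    assume "\<exists>i. a = Suc i \<and> b = Suc (\<pi> i) \<and> i < \<pi> i \<and> i < 2 * m"
    then obtain i where "a = Suc i" "b = Suc (\<pi> i)" "i < \<pi> i" "P i (\<pi> i)" using P by blast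
    then show "(a, b) \<in> E" using less unfolding P_def by fastforce
  qed
  have "connected_involution (2 * m) \<pi>"
  proof
    show "0 < 2 * m" using \<open>m \<ge> 1\<close> by simp
    show "\<pi> i < 2 * m" "\<pi> i \<noteq> i" "\<pi> (\<pi> i) = i" if "i < 2 * m" for i
      using lt[OF P[OF that]] \<pi>_eqI by blast+
    show "\<exists>a<i. i < \<pi> a" if i: "0 < i" "Suc i < 2 * m" for i
    proof -
      obtain e where "e \<in> E" "nests_vertex e (Suc i)"
        using conn i unfolding connected_matching_def by fastforce
      then show ?thesis using E_iff[of "fst e" "snd e"] by (auto simp: nests_vertex_def)
    qed
  qed
  then show thesis using E_iff by (rule that)
qed

text \<open>Infinite types admit injections of all positions, so each connected matching has a
  representative over the given types.\<close>

lemma exists_rooted_map_Phi_eq: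
  assumes "connected_matching m E" "m \<ge> 1"
  obtains M :: "('v::infinite, 'd::infinite) rmap" where "rooted_map M" "Phi M = E"
proof -
  obtain \<pi> where \<pi>: "connected_involution (2 * m) \<pi>"
    and E: "\<And>a b. (a, b) \<in> E \<longleftrightarrow> (\<exists>i. a = Suc i \<and> b = Suc (\<pi> i) \<and> i < \<pi> i \<and> i < 2 * m)"
    using connected_matching_involution[OF assms] by blast
  obtain \<iota> :: "nat \<Rightarrow> 'd" where \<iota>: "inj \<iota>" using arb_countable_map[of "{}"] by auto
  obtain \<kappa> :: "nat \<Rightarrow> 'v" where \<kappa>: "inj \<kappa>" using arb_countable_map[of "{}"] by auto
  interpret connected_involution "2 * m" \<pi> by (fact \<pi>)
  show thesis
  proof (rule that)
    show "rooted_map (rmap_of \<iota> \<kappa>)" by (rule rooted_rmap_of[OF \<iota> \<kappa>])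
    show "Phi (rmap_of \<iota> \<kappa>) = E"
      using Phi_rmap_of[OF \<iota> \<kappa>] E by (intro set_eqI) (simp add: split_paired_all)
  qed
qed

theorem mainTheorem7:
  fixes n k :: nat
  assumes "k \<ge> 1"
  shows "Phi respects (map_iso :: (('v :: infinite, 'd :: infinite) rmap \<times> ('v, 'd) rmap) set) \<and>
    (\<forall>M \<in> (rooted_maps n k :: ('v, 'd) rmap set). matching_weight (Phi M) = map_weight M) \<and>
    bij_betw Phi_class ((rooted_maps n k :: ('v, 'd) rmap set) // map_iso)
      {E. connected_matching (n + 1) E \<and> matching_weight E = weight_c ^ (k - 1)}"
proof (intro conjI ballI)
  let ?R = "map_iso :: (('v, 'd) rmap \<times> ('v, 'd) rmap) set"
  let ?S = "rooted_maps n k :: ('v, 'd) rmap set"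
  show resp: "Phi respects ?R"
    unfolding congruent_def map_iso_def using Phi_isomorphic by blast
  show "matching_weight (Phi M) = map_weight M" if "M \<in> ?S" for M
    using that matching_weight_Phi[of M] by (simp add: rooted_maps_def)
  have cls: "Phi_class (?R `` {M}) = Phi M" if "rooted_map M" for M
  proof -
    have "M \<in> ?R `` {M}" using equiv_class_self[OF equiv_map_iso] that by blast
    \<comment> \<open>Invariance makes the image of a class a singleton, so that
      \<open>the_elem\<close> yields the common value.\<close>
    then have "Phi ` (?R `` {M}) = {Phi M}"
      using resp by (auto simp: congruent_def)
    then show ?thesis by (simp add: Phi_class_def)
  qed
  have quot: "?S // ?R = (\<lambda>M. ?R `` {M}) ` ?S" by (auto simp: quotient_def)
  show "bij_betw Phi_class (?S // ?R)
      {E. connected_matching (n + 1) E \<and> matching_weight E = weight_c ^ (k - 1)}"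
    unfolding bij_betw_def
  proof
    show "inj_on Phi_class (?S // ?R)"
      unfolding quot
    proof (rule inj_onI, clarify)
      fix M N :: "('v, 'd) rmap"
      assume M: "M \<in> ?S" and N: "N \<in> ?S"
        and eq: "Phi_class (?R `` {M}) = Phi_class (?R `` {N})"
      have MN: "rooted_map M" "rooted_map N" "card (ends M) = card (ends N)"
        using M N by (auto simp: rooted_maps_def card_ends)
      then have "(M, N) \<in> ?R"
        using eq cls Phi_eq_imp_isomorphic[of M N] by (simp add: map_iso_def)
      then show "?R `` {M} = ?R `` {N}" by (rule equiv_class_eq[OF equiv_map_iso])
    qed
    show "Phi_class ` (?S // ?R) =
        {E. connected_matching (n + 1) E \<and> matching_weight E = weight_c ^ (k - 1)}"
      unfolding quot image_image
    proof (intro equalityI subsetI)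
      fix E assume "E \<in> (\<lambda>M. Phi_class (?R `` {M})) ` ?S"
      then obtain M where "M \<in> ?S" "E = Phi M" using cls by (auto simp: rooted_maps_def)
      then show "E \<in> {E. connected_matching (n + 1) E \<and> matching_weight E = weight_c ^ (k - 1)}"
        using Phi_connected_matching[of M] matching_weight_Phi[of M] map_weight_eq[of M]
        by (auto simp: rooted_maps_def)
    next
      fix E assume "E \<in> {E. connected_matching (n + 1) E \<and> matching_weight E = weight_c ^ (k - 1)}"
      then have E: "connected_matching (n + 1) E" "matching_weight E = weight_c ^ (k - 1)" by auto
      obtain M :: "('v, 'd) rmap" where M: "rooted_map M" "Phi M = E"
        using exists_rooted_map_Phi_eq[OF E(1)] by auto
      \<comment> \<open>The number of edges is recovered from the set of vertices that the matching
        covers, the number of vertices of the map from the exponent of the weight.\<close>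
      have "{1..2 * (card (edges M) + 1)} = {1..2 * (n + 1)}"
        using matching_Union[of "card (edges M) + 1" E] matching_Union[of "n + 1" E] E(1)
          Phi_connected_matching[OF M(1)] M(2) unfolding connected_matching_def by metis
      then have "card {1..2 * (card (edges M) + 1)} = card {1..2 * (n + 1)}" by (rule arg_cong)
      then have "card (edges M) = n" by simp
      moreover have "card (verts M) - 1 = k - 1"
        using matching_weight_Phi[OF M(1)] map_weight_eq[OF M(1)] M(2) E(2)
        by (simp add: weight_c_power_eq_iff)
      \<comment> \<open>Equality of the exponents determines the number of vertices because it and
        \<open>k\<close> are positive.\<close>
      moreover have "card (verts M) \<ge> 1"
        using finite_verts[OF M(1)] verts_nonempty[OF M(1)] by (simp add: Suc_le_eq card_gt_0_iff)
      ultimately have "M \<in> ?S" using M(1) assms by (simp add: rooted_maps_def)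
      then show "E \<in> (\<lambda>M. Phi_class (?R `` {M})) ` ?S"
        using cls[OF M(1)] M(2) by (intro image_eqI[of _ _ M]) auto
    qed
  qed
qed

end
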